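(* For all positive integers $m$ and $n$, the pair $(D_n,2m)$ is rate-monotonic, where $D_n$ is the dihedral group of order $2n$. Explicitly: for all symmetric generating rate collections $\boldsymbol{\lambda},\boldsymbol{\lambda}'\in\mathbb{R}_{\ge 0}^{D_n}$ with $\boldsymbol{\lambda}\le\boldsymbol{\lambda}'$ and all real $t\ge 0$, one has $d_{2m}^{\boldsymbol{\lambda}}(t)\ge d_{2m}^{\boldsymbol{\lambda}'}(t)$.
   Context: $D_n=\langle r,b\mid r^n=b^2=e,\ brb=r^{-1}\rangle$ is the dihedral group of order $2n$ (for every integer $n\ge 1$). Let $G$ be a finite group with identity $e$. A rate collection is $\boldsymbol{\lambda}=(\lambda_s)_{s\in G}\in\mathbb{R}_{\ge 0}^G$. It is symmetric if $\lambda_s=\lambda_{s^{-1}}$ for all $s\in G$, and generating if its support $\{s\in G:\lambda_s>0\}$ generates $G$. Write $\boldsymbol{\lambda}\le\boldsymbol{\lambda}'$ if $\lambda_s\le\lambda'_s$ for all $s\in G$. The continuous-time random walk $(X_t^{\boldsymbol{\lambda}})_{t\ge 0}$ on $G$ driven by $\boldsymbol{\lambda}$ starts at $e$ at time $0$. Each $s\in G$ has an independent Poisson clock of rate $\lambda_s$, and whenever the clock of $s$ rings, the current state is multiplied by $s$ on the right (so it is the continuous-time Markov chain with jump rate $\lambda_s$ from $g$ to $gs$). Let $P_t^{\boldsymbol{\lambda}}(g)=\mathbb{P}(X_t^{\boldsymbol{\lambda}}=g)$. For $1\le p<\infty$, let $$d_p^{\boldsymbol{\lambda}}(t)=\Bigl(\sum_{g\in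 G}\bigl|P_t^{\boldsymbol{\lambda}}(g)-\tfrac{1}{|G|}\bigr|^p\Bigr)^{1/p}.$$ The pair $(G,p)$ is rate-monotonic if for all symmetric generating $\boldsymbol{\lambda},\boldsymbol{\lambda}'\in\mathbb{R}_{\ge 0}^G$ with $\boldsymbol{\lambda}\le\boldsymbol{\lambda}'$, one has $d_p^{\boldsymbol{\lambda}}(t)\ge d_p^{\boldsymbol{\lambda}'}(t)$ for all real $t\ge 0$. *)

theory Defs
  imports "HOL-Probability.Probability" "HOL-Algebra.Generated_Groups"
begin

(* Together with the order 2 * n, the relations of the presentation determine the group up to
   isomorphism.  The degenerate cases n = 1 (r trivial, cyclic of order 2) and n = 2 (Klein four)
   are included. *)
definition dihedral_group :: "nat \<Rightarrow> ('a, 'b) monoid_scheme \<Rightarrow> bool" where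
  "dihedral_group n G \<longleftrightarrow>
     group G \<and> order G = 2 * n \<and>
     (\<exists>r\<in>carrier G. \<exists>b\<in>carrier G.
        generate G {r, b} = carrier G \<and>
        r [^]\<^bsub>G\<^esub> n = \<one>\<^bsub>G\<^esub> \<and> b [^]\<^bsub>G\<^esub> (2::nat) = \<one>\<^bsub>G\<^esub> \<and>
        b \<otimes>\<^bsub>G\<^esub> r \<otimes>\<^bsub>G\<^esub> b = inv\<^bsub>G\<^esub> r)"

definition rate_collection :: "('a, 'b) monoid_scheme \<Rightarrow> ('a \<Rightarrow> real) \<Rightarrow> bool" where
  "rate_collection G lam \<longleftrightarrow> (\<forall>s\<in>carrier G. 0 \<le> lam s)"

definition symmetric_rates :: "('a, 'b) monoid_scheme \<Rightarrow> ('a \<Rightarrow> real) \<Rightarrow> bool" where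
  "symmetric_rates G lam \<longleftrightarrow> (\<forall>s\<in>carrier G. lam s = lam (inv\<^bsub>G\<^esub> s))"

definition generating_rates :: "('a, 'b) monoid_scheme \<Rightarrow> ('a \<Rightarrow> real) \<Rightarrow> bool" where
  "generating_rates G lam \<longleftrightarrow> generate G {s \<in> carrier G. 0 < lam s} = carrier G"

(* N t counts the rings in the time interval (0, t].  The marginal law is written out because
   poisson_pmf is specified for positive parameters only, whereas the rate may be 0 here. *)
locale poisson_process = prob_space M for M :: "'w measure" +
  fixes rate :: real and N :: "real \<Rightarrow> 'w \<Rightarrow> nat"
  assumes rate_nonneg: "0 \<le> rate"
    and random_variable_count: "0 \<le> t \<Longrightarrow> random_variable (count_space UNIV) (N t)"
    and count_0: "\<omega> \<in> space M \<Longrightarrow> N 0 \<omega> = 0"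
    and count_mono: "\<omega> \<in> space M \<Longrightarrow> mono_on {0..} (\<lambda>t. N t \<omega>)"
    and count_right_continuous:
      "\<omega> \<in> space M \<Longrightarrow> 0 \<le> t \<Longrightarrow> continuous (at_right t) (\<lambda>u. N u \<omega>)"
    and poisson_increments: "0 \<le> a \<Longrightarrow> a \<le> b \<Longrightarrow>
      prob {\<omega> \<in> space M. N b \<omega> - N a \<omega> = k} =
        (rate * (b - a)) ^ k / fact k * exp (- (rate * (b - a)))"
    and independent_increments: "0 \<le> \<tau> 0 \<Longrightarrow> (\<And>i. i < k \<Longrightarrow> \<tau> i \<le> \<tau> (Suc i)) \<Longrightarrow>
      indep_vars (\<lambda>_. count_space UNIV) (\<lambda>i \<omega>. N (\<tau> (Suc i)) \<omega> - N (\<tau> i) \<omega>) {..<k}"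

(* N s is the clock of s, and the clocks are independent as processes.  The evolution of X is
   expressed on time intervals (a, b] containing no ring or exactly one ring.  Since
   simultaneous rings form a null event, this determines X almost surely. *)
locale random_walk = prob_space M + group G
  for M :: "'w measure" and G :: "('a, 'b) monoid_scheme" (structure) +
  fixes lam :: "'a \<Rightarrow> real"
    and N :: "'a \<Rightarrow> real \<Rightarrow> 'w \<Rightarrow> nat"
    and X :: "real \<Rightarrow> 'w \<Rightarrow> 'a"
  assumes finite_group: "finite (carrier G)"
    and poisson_clocks: "s \<in> carrier G \<Longrightarrow> poisson_process M (lam s) (N s)"
    and independent_clocks:
      "indep_vars (\<lambda>_. PiM {0..} (\<lambda>_. count_space UNIV))
         (\<lambda>s \<omega>. \<lambda>t\<in>{0..}. N s t \<omega>) (carrier G)"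
    and random_variable_walk: "0 \<le> t \<Longrightarrow> random_variable (count_space (carrier G)) (X t)"
    and walk_start: "\<omega> \<in> space M \<Longrightarrow> X 0 \<omega> = \<one>"
    and walk_no_ring: "\<omega> \<in> space M \<Longrightarrow> 0 \<le> a \<Longrightarrow> a \<le> b \<Longrightarrow>
      (\<And>s. s \<in> carrier G \<Longrightarrow> N s b \<omega> = N s a \<omega>) \<Longrightarrow> X b \<omega> = X a \<omega>"
    and walk_one_ring: "\<omega> \<in> space M \<Longrightarrow> 0 \<le> a \<Longrightarrow> a \<le> b \<Longrightarrow> s \<in> carrier G \<Longrightarrow>
      N s b \<omega> = N s a \<omega> + 1 \<Longrightarrow>
      (\<And>s'. s' \<in> carrier G \<Longrightarrow> s' \<noteq> s \<Longrightarrow> N s' b \<omega> = N s' a \<omega>) \<Longrightarrow>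
      X b \<omega> = X a \<omega> \<otimes> s"

definition walk_prob :: "'w measure \<Rightarrow> (real \<Rightarrow> 'w \<Rightarrow> 'a) \<Rightarrow> real \<Rightarrow> 'a \<Rightarrow> real" where
  "walk_prob M X t g = measure M {\<omega> \<in> space M. X t \<omega> = g}"

definition lp_distance ::
  "('a, 'b) monoid_scheme \<Rightarrow> real \<Rightarrow> 'w measure \<Rightarrow> (real \<Rightarrow> 'w \<Rightarrow> 'a) \<Rightarrow> real \<Rightarrow> real" where
  "lp_distance G p M X t =
     (\<Sum>g\<in>carrier G. \<bar>walk_prob M X t g - 1 / real (order G)\<bar> powr p) powr (1 / p)"

end

theory Submission
  imports Defs
begin

text \<open>Restricting \<open>P_t - 1/|G|\<close> to the rotations and to the reflections gives two functions on
  \<open>\<int>/n\<close>, with Fourier coefficients \<open>F k\<close> and \<open>H k\<close>; in the two-dimensional representation number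
  \<open>k\<close> the generator is a hermitian matrix with constant real diagonal, so \<open>F\<close> is a \<open>cosh\<close> and \<open>H\<close>
  a \<open>sinh\<close> expression in the off-diagonal entry. Let \<open>u\<close> be the joint function. The derivative of
  \<open>u\<close> in the direction of the rate of \<open>s\<close> has the form \<open>t (v - u)\<close>. By the tangent inequality
  \<open>q a^(q-1) (c - a) \<le> c^q - a^q\<close> for the even number \<open>q = 2m\<close>, the sum of \<open>u^q\<close> decreases as soon
  as \<open>\<Sum> v^q \<le> \<Sum> u^q\<close>. If \<open>s\<close> is a rotation, \<open>v\<close> averages translates of \<open>u\<close>. If \<open>s\<close> is a reflection,
  \<open>v\<close> on the rotations averages translates of \<open>u\<close> on the reflections, while on the reflections the
  Fourier coefficients of \<open>v\<close> are bounded in modulus by \<open>F\<close>; as \<open>q\<close> is even, the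
  Hardy--Littlewood majorant property then bounds \<open>\<Sum> v^q\<close> over the reflections by the sum of \<open>u^q\<close>
  over the rotations.\<close>

section \<open>Fourier sums on a cyclic group and the majorant property\<close>

lemma periodic_sum_shift:
  fixes \<phi> :: "int \<Rightarrow> 'a::comm_monoid_add"
  assumes "n > 0" and per: "\<And>j. \<phi> (j mod int n) = \<phi> j"
  shows "(\<Sum>j\<in>{0..<int n}. \<phi> (l + j)) = (\<Sum>j\<in>{0..<int n}. \<phi> j)"
proof (rule sum.reindex_bij_witness[where i = "\<lambda>j. (j - l) mod int n" and j = "\<lambda>j. (l + j) mod int n"])
  fix a assume a: "a \<in> {0..<int n}"
  show "((l + a) mod int n - l) mod int n = a" using a by (simp add: mod_simps)
  show "(l + (a - l) mod int n) mod int n = a" using a by (simp add: mod_simps)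
  show "(l + a) mod int n \<in> {0..<int n}" "(a - l) mod int n \<in> {0..<int n}"
    using \<open>n > 0\<close> by auto
  show "\<phi> ((l + a) mod int n) = \<phi> (l + a)" by (rule per)
qed

lemma periodic_sum_reflect:
  fixes \<phi> :: "int \<Rightarrow> 'a::comm_monoid_add"
  assumes "n > 0" and per: "\<And>j. \<phi> (j mod int n) = \<phi> j"
  shows "(\<Sum>j\<in>{0..<int n}. \<phi> (l - j)) = (\<Sum>j\<in>{0..<int n}. \<phi> j)"
proof (rule sum.reindex_bij_witness[where i = "\<lambda>j. (l - j) mod int n" and j = "\<lambda>j. (l - j) mod int n"])
  fix a assume a: "a \<in> {0..<int n}"
  show "(l - (l - a) mod int n) mod int n = a" using a by (simp add: mod_simps)
  show "(l - (l - a) mod int n) mod int n = a" using a by (simp add: mod_simps)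
  show "(l - a) mod int n \<in> {0..<int n}" "(l - a) mod int n \<in> {0..<int n}"
    using \<open>n > 0\<close> by auto
  show "\<phi> ((l - a) mod int n) = \<phi> (l - a)" by (rule per)
qed

section \<open>Roots of unity and orthogonality of characters\<close>

definition unity_root :: "nat \<Rightarrow> int \<Rightarrow> complex" where
  "unity_root n j = cis (2 * pi * real_of_int j / real n)"

lemma unity_root_0 [simp]: "unity_root n 0 = 1"
  by (simp add: unity_root_def)

lemma unity_root_add: "unity_root n (i + j) = unity_root n i * unity_root n j"
  by (simp add: unity_root_def cis_mult add_divide_distrib distrib_left)

lemma unity_root_minus: "unity_root n (- j) = cnj (unity_root n j)"
  by (simp add: unity_root_def cis_cnj)

lemma norm_unity_root [simp]: "norm (unity_root n j) = 1"
  by (simp add: unity_root_def)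

lemma unity_root_sum: "unity_root n (\<Sum>i\<in>I. f i) = (\<Prod>i\<in>I. unity_root n (f i))"
  by (induction I rule: infinite_finite_induct) (auto simp: unity_root_add)

lemma unity_root_eq_1_iff:
  assumes "n > 0" shows "unity_root n j = 1 \<longleftrightarrow> int n dvd j"
proof -
  have "unity_root n j = 1 \<longleftrightarrow> (\<exists>z::int. 2 * pi * real_of_int j / real n = real_of_int (2 * z) * pi)"
    unfolding unity_root_def cis_conv_exp exp_eq_1 by simp
  also have "\<dots> \<longleftrightarrow> (\<exists>z::int. real_of_int j = real_of_int (int n * z))"
    using assms by (intro ex_cong1) (auto simp: field_simps)
  also have "\<dots> \<longleftrightarrow> int n dvd j"
    unfolding of_int_eq_iff dvd_def ..
  finally show ?thesis .
qed

lemma unity_root_mod_mult: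
  assumes "n > 0" shows "unity_root n ((j mod int n) * k) = unity_root n (j * k)"
proof -
  have "unity_root n (j * k) = unity_root n ((j mod int n) * k + int n * (j div int n * k))"
    by (metis (no_types, opaque_lifting) distrib_right mod_mult_div_eq mult.assoc)
  also have "\<dots> = unity_root n ((j mod int n) * k)"
    unfolding unity_root_add using unity_root_eq_1_iff[OF assms] by auto
  finally show ?thesis ..
qed

text \<open>Multiplication by \<open>unity_root n M\<close> shifts the summation index by one and so
  fixes the sum, which must vanish unless this factor is 1.\<close>

lemma sum_unity_root:
  assumes "n > 0"
  shows "(\<Sum>j\<in>{0..<int n}. unity_root n (j * M)) = (if int n dvd M then of_nat n else 0)"
proof -
  let ?S = "\<Sum>j\<in>{0..<int n}. unity_root n (j * M)"
  have "unity_root n M * ?S = (\<Sum>j\<in>{0..<int n}. unity_root n ((1 + j) * M))"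
    by (simp add: sum_distrib_left unity_root_add algebra_simps)
  also have "\<dots> = ?S"
    by (rule periodic_sum_shift[OF assms, where \<phi> = "\<lambda>j. unity_root n (j * M)"])
       (rule unity_root_mod_mult[OF assms])
  finally have "(unity_root n M - 1) * ?S = 0" by (simp add: algebra_simps)
  moreover have "?S = of_nat n" if "int n dvd M"
  proof -
    have "?S = (\<Sum>j\<in>{0..<int n}. 1)"
      using that by (intro sum.cong) (auto simp: unity_root_eq_1_iff[OF assms])
    then show ?thesis by simp
  qed
  ultimately show ?thesis
    using unity_root_eq_1_iff[OF assms, of M] by auto
qed

text \<open>The Hardy--Littlewood majorant property: expanding an integer power, the sum over \<open>j\<close>
  annihilates all frequencies except the multiples of \<open>n\<close>, which get a positive weight.\<close>

lemma majorant_power: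
  fixes K :: "'i \<Rightarrow> complex" and F :: "'i \<Rightarrow> real" and \<nu> :: "'i \<Rightarrow> int"
  assumes "n > 0" "finite I" and le: "\<And>i. i \<in> I \<Longrightarrow> norm (K i) \<le> F i"
  shows "norm (\<Sum>j\<in>{0..<int n}. (\<Sum>i\<in>I. K i * unity_root n (j * \<nu> i)) ^ q)
    \<le> Re (\<Sum>j\<in>{0..<int n}. (\<Sum>i\<in>I. of_real (F i) * unity_root n (j * \<nu> i)) ^ q)"
proof -
  define W where "W = PiE {..<q} (\<lambda>_. I)"
  define d where "d \<kappa> = (if int n dvd (\<Sum>i<q. \<nu> (\<kappa> i)) then real n else 0)" for \<kappa>
  have expand: "(\<Sum>j\<in>{0..<int n}. (\<Sum>i\<in>I. C i * unity_root n (j * \<nu> i)) ^ q)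
      = (\<Sum>\<kappa>\<in>W. (\<Prod>i<q. C (\<kappa> i)) * of_real (d \<kappa>))" for C :: "'i \<Rightarrow> complex"
  proof -
    have "(\<Sum>i\<in>I. C i * unity_root n (j * \<nu> i)) ^ q
        = (\<Sum>\<kappa>\<in>W. (\<Prod>i<q. C (\<kappa> i)) * unity_root n (j * (\<Sum>i<q. \<nu> (\<kappa> i))))" for j
    proof -
      have "(\<Sum>i\<in>I. C i * unity_root n (j * \<nu> i)) ^ q
          = (\<Prod>p<q. \<Sum>i\<in>I. C i * unity_root n (j * \<nu> i))" by simp
      also have "\<dots> = (\<Sum>\<kappa>\<in>W. \<Prod>p<q. C (\<kappa> p) * unity_root n (j * \<nu> (\<kappa> p)))"
        unfolding W_def using \<open>finite I\<close> by (intro prod_sum_PiE) auto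
      finally show ?thesis by (simp add: prod.distrib sum_distrib_left unity_root_sum)
    qed
    then have "(\<Sum>j\<in>{0..<int n}. (\<Sum>i\<in>I. C i * unity_root n (j * \<nu> i)) ^ q)
      = (\<Sum>\<kappa>\<in>W. (\<Prod>i<q. C (\<kappa> i)) * (\<Sum>j\<in>{0..<int n}. unity_root n (j * (\<Sum>i<q. \<nu> (\<kappa> i)))))"
      by (simp add: sum.swap[of _ W] sum_distrib_left)
    then show ?thesis
      unfolding sum_unity_root[OF \<open>n > 0\<close>] d_def by (auto intro!: sum.cong)
  qed
  have "norm (\<Sum>\<kappa>\<in>W. (\<Prod>i<q. K (\<kappa> i)) * of_real (d \<kappa>))
      \<le> (\<Sum>\<kappa>\<in>W. (\<Prod>i<q. F (\<kappa> i)) * d \<kappa>)"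
  proof (rule order_trans[OF norm_sum sum_mono])
    fix \<kappa> assume "\<kappa> \<in> W"
    then have "\<kappa> i \<in> I" if "i < q" for i using that by (auto simp: W_def)
    then have "(\<Prod>i<q. norm (K (\<kappa> i))) \<le> (\<Prod>i<q. F (\<kappa> i))" by (intro prod_mono) (auto intro: le)
    then show "norm ((\<Prod>i<q. K (\<kappa> i)) * of_real (d \<kappa>)) \<le> (\<Prod>i<q. F (\<kappa> i)) * d \<kappa>"
      by (auto simp: norm_mult prod_norm[symmetric] d_def intro!: mult_right_mono)
  qed
  also have "\<dots> = Re (\<Sum>\<kappa>\<in>W. (\<Prod>i<q. of_real (F (\<kappa> i))) * of_real (d \<kappa>))"
    by (simp flip: of_real_prod of_real_mult of_real_sum)
  finally show ?thesis unfolding expand .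
qed

text \<open>The inverse discrete Fourier transform, of which only the real part is kept: the result
  is real for any coefficients, so no Hermitian symmetry has to be carried along.\<close>

definition synth :: "nat \<Rightarrow> (int \<Rightarrow> complex) \<Rightarrow> int \<Rightarrow> real" where
  "synth n C j = Re (\<Sum>k\<in>{0..<int n}. C k * unity_root n (j * k)) / real n"

lemma synth_mod:
  "n > 0 \<Longrightarrow> synth n C (j mod int n) = synth n C j"
  by (simp add: synth_def unity_root_mod_mult)

lemma synth_cong: "(\<And>k. k \<in> {0..<int n} \<Longrightarrow> C k = D k) \<Longrightarrow> synth n C j = synth n D j"
  unfolding synth_def by (intro arg_cong2[of _ _ _ _ "(/)"] arg_cong[of _ _ Re] sum.cong) auto

lemma synth_add: "synth n (\<lambda>k. C k + D k) j = synth n C j + synth n D j"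
  by (simp add: synth_def distrib_right sum.distrib add_divide_distrib del: times_complex.sel)

lemma synth_diff: "synth n (\<lambda>k. C k - D k) j = synth n C j - synth n D j"
  by (simp add: synth_def left_diff_distrib sum_subtractf diff_divide_distrib del: times_complex.sel)

lemma synth_scale: "synth n (\<lambda>k. of_real c * C k) j = c * synth n C j"
proof -
  have "(\<Sum>k\<in>{0..<int n}. of_real c * C k * unity_root n (j * k))
      = of_real c * (\<Sum>k\<in>{0..<int n}. C k * unity_root n (j * k))"
    by (simp add: sum_distrib_left mult.assoc)
  then show ?thesis by (simp add: synth_def)
qed

lemma synth_sum: "synth n (\<lambda>k. \<Sum>l\<in>L. C l k) j = (\<Sum>l\<in>L. synth n (C l) j)"
  by (induction L rule: infinite_finite_induct)
     (simp_all add: synth_add, simp_all add: synth_def)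

lemma synth_shift: "synth n (\<lambda>k. C k * unity_root n (l * k)) j = synth n C (j + l)"
  by (simp add: synth_def unity_root_add algebra_simps)

text \<open>A real part does not change under conjugation of the whole sum, and this conjugation
  reverses the sign of \<open>j\<close> in the characters.\<close>

lemma synth_cnj: "synth n (\<lambda>k. cnj (C k)) j = synth n C (- j)"
proof -
  have "Re (\<Sum>k\<in>{0..<int n}. cnj (C k) * unity_root n (j * k))
     = Re (cnj (\<Sum>k\<in>{0..<int n}. cnj (C k) * unity_root n (j * k)))" by simp
  also have "cnj (\<Sum>k\<in>{0..<int n}. cnj (C k) * unity_root n (j * k))
     = (\<Sum>k\<in>{0..<int n}. C k * unity_root n (- j * k))"
    by (simp add: unity_root_minus)
  finally show ?thesis by (simp add: synth_def)
qed

text \<open>A real part is half the sum of a number and its conjugate, so \<open>synth\<close> is a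
  genuine Fourier sum indexed by a frequency and a sign. Both coefficients belonging to one
  frequency have the same modulus, and \<open>majorant_power\<close> applies.\<close>

lemma synth_majorant:
  assumes "n > 0" and le: "\<And>k. k \<in> {0..<int n} \<Longrightarrow> norm (K k) \<le> F k"
  shows "(\<Sum>j\<in>{0..<int n}. synth n K j ^ q)
    \<le> (\<Sum>j\<in>{0..<int n}. synth n (\<lambda>k. of_real (F k)) j ^ q)"
proof -
  define I where "I = {0..<int n} \<times> (UNIV :: bool set)"
  define \<nu> where "\<nu> i = (if snd i then fst i else - fst i)" for i :: "int \<times> bool"
  define T where "T C i = (if snd i then C (fst i) else cnj (C (fst i))) / (2 * of_nat n)"
    for C :: "int \<Rightarrow> complex" and i :: "int \<times> bool"
  have synth_eq: "of_real (synth n C j) = (\<Sum>i\<in>I. T C i * unity_root n (j * \<nu> i))" for C j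
  proof -
    have "(\<Sum>i\<in>I. T C i * unity_root n (j * \<nu> i))
      = (\<Sum>k\<in>{0..<int n}. \<Sum>s\<in>UNIV. T C (k, s) * unity_root n (j * \<nu> (k, s)))"
      unfolding I_def by (simp add: sum.cartesian_product)
    also have "\<dots> = (\<Sum>k\<in>{0..<int n}. (C k * unity_root n (j * k) + cnj (C k * unity_root n (j * k)))
        / (2 * of_nat n))"
      by (simp add: UNIV_bool T_def \<nu>_def unity_root_minus add_divide_distrib add.commute)
    also have "\<dots> = (\<Sum>k\<in>{0..<int n}. of_real (Re (C k * unity_root n (j * k)) / real n))"
      unfolding complex_add_cnj by (intro sum.cong) (auto simp del: times_complex.sel)
    also have "\<dots> = of_real (synth n C j)"
      by (simp add: synth_def sum_divide_distrib del: times_complex.sel)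
    finally show ?thesis ..
  qed
  have "(\<Sum>j\<in>{0..<int n}. synth n K j ^ q)
      \<le> norm (of_real (\<Sum>j\<in>{0..<int n}. synth n K j ^ q) :: complex)"
    unfolding norm_of_real by simp
  also have "\<dots> = norm (\<Sum>j\<in>{0..<int n}. (\<Sum>i\<in>I. T K i * unity_root n (j * \<nu> i)) ^ q)"
    by (simp add: synth_eq)
  also have "\<dots> \<le> Re (\<Sum>j\<in>{0..<int n}.
      (\<Sum>i\<in>I. of_real (F (fst i) / (2 * real n)) * unity_root n (j * \<nu> i)) ^ q)"
    using \<open>n > 0\<close> le
    by (intro majorant_power) (auto simp: I_def T_def norm_divide norm_mult intro!: divide_right_mono)
  also have "\<dots> = Re (\<Sum>j\<in>{0..<int n}. of_real (synth n (\<lambda>k. of_real (F k)) j) ^ q)"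
    unfolding synth_eq by (intro arg_cong[of _ _ Re] sum.cong arg_cong2[of _ _ _ _ "(^)"] refl) (auto simp: T_def)
  finally show ?thesis by (simp flip: of_real_power of_real_sum)
qed

section \<open>Hyperbolic functions of a square root\<close>

text \<open>This is cosh (sqrt y) for y >= 0, written as a power series. Its argument will be
  \<open>(t * norm b)\<^sup>2\<close>, a polynomial in the real and imaginary parts of b, so
  derivatives exist also at b = 0, where \<open>norm b\<close> has none.\<close>

definition cosh_sqrt :: "real \<Rightarrow> real" where
  "cosh_sqrt y = (\<Sum>k. 1 / fact (2 * k) * y ^ k)"

text \<open>This is sinh (sqrt y) / sqrt y for y > 0, with the value 1 at y = 0.\<close>

definition sinhc_sqrt :: "real \<Rightarrow> real" where
  "sinhc_sqrt y = (\<Sum>k. 1 / fact (2 * k + 1) * y ^ k)"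

definition sinhc_sqrt' :: "real \<Rightarrow> real" where
  "sinhc_sqrt' y = (\<Sum>k. diffs (\<lambda>k. 1 / fact (2 * k + 1)) k * y ^ k)"

lemma fact_le_fact_double: "(fact k :: real) \<le> fact (2 * k)"
  by (intro fact_mono) auto

lemma summable_cosh_sqrt: "summable (\<lambda>k. 1 / fact (2 * k) * (y::real) ^ k)"
proof (rule summable_comparison_test[OF _ summable_norm_exp[of y]], intro exI allI impI)
  fix k :: nat
  have "\<bar>y\<bar> ^ k / fact (2 * k) \<le> \<bar>y\<bar> ^ k / fact k"
    using fact_le_fact_double[of k] by (intro divide_left_mono) auto
  then show "norm (1 / fact (2 * k) * y ^ k) \<le> norm (y ^ k /\<^sub>R fact k)"
    by (simp add: abs_mult power_abs divide_inverse mult.commute)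
qed

lemma summable_sinhc_sqrt: "summable (\<lambda>k. 1 / fact (2 * k + 1) * (y::real) ^ k)"
proof (rule summable_comparison_test[OF _ summable_norm_exp[of y]], intro exI allI impI)
  fix k :: nat
  have "fact k \<le> (fact (2 * k + 1) :: real)" by (intro fact_mono) auto
  then have "\<bar>y\<bar> ^ k / fact (2 * k + 1) \<le> \<bar>y\<bar> ^ k / fact k"
    by (intro divide_left_mono) (auto simp del: fact_Suc)
  then show "norm (1 / fact (2 * k + 1) * y ^ k) \<le> norm (y ^ k /\<^sub>R fact k)"
    by (simp add: abs_mult power_abs divide_inverse mult.commute del: fact_Suc)
qed

lemma cosh_sqrt_square: "cosh_sqrt (x\<^sup>2) = cosh x"
proof -
  have "(\<lambda>k. if even k then x ^ k /\<^sub>R fact k else 0) sums cosh x" by (rule cosh_converges)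
  then have "(\<lambda>k. x ^ (2 * k) /\<^sub>R fact (2 * k)) sums cosh x"
    by (subst (asm) sums_mono_reindex[of "\<lambda>k. 2 * k", symmetric])
       (auto simp: strict_mono_def elim!: evenE)
  then show ?thesis
    by (simp add: cosh_sqrt_def sums_iff divide_inverse mult.commute flip: power_mult)
qed

lemma sinhc_sqrt_square: "x * sinhc_sqrt (x\<^sup>2) = sinh x"
proof -
  have "(\<lambda>k. if even k then 0 else x ^ k /\<^sub>R fact k) sums sinh x" by (rule sinh_converges)
  then have "(\<lambda>k. x ^ (2 * k + 1) /\<^sub>R fact (2 * k + 1)) sums sinh x"
    by (subst (asm) sums_mono_reindex[of "\<lambda>k. 2 * k + 1", symmetric])
       (auto simp: strict_mono_def elim!: oddE)
  moreover have "(\<lambda>k. x * (1 / fact (2 * k + 1) * (x\<^sup>2) ^ k)) sums (x * sinhc_sqrt (x\<^sup>2))"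
    unfolding sinhc_sqrt_def by (intro sums_mult summable_sums summable_sinhc_sqrt)
  moreover have "x * (1 / fact (2 * k + 1) * (x\<^sup>2) ^ k) = x ^ (2 * k + 1) /\<^sub>R fact (2 * k + 1)" for k
    by (simp add: divide_inverse mult.commute del: fact_Suc flip: power_mult)
  ultimately show ?thesis using sums_unique2 by auto
qed

text \<open>Termwise differentiation produces the coefficient (k + 1) / (2k + 2)! = 1 / (2 (2k +
  1)!).\<close>

lemma has_derivative_cosh_sqrt: "(cosh_sqrt has_field_derivative sinhc_sqrt y / 2) (at y)"
proof -
  have "(cosh_sqrt has_field_derivative (\<Sum>k. diffs (\<lambda>k. 1 / fact (2 * k)) k * y ^ k)) (at y)"
    unfolding cosh_sqrt_def[abs_def]
    by (rule termdiffs_strong_converges_everywhere) (rule summable_cosh_sqrt)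
  moreover have "diffs (\<lambda>k. 1 / fact (2 * k)) k = (1 / fact (2 * k + 1) / 2 :: real)" for k
  proof -
    have "(fact (2 * Suc k) :: real) = 2 * (1 + real k) * fact (2 * k + 1)"
      by (simp add: algebra_simps)
    then have "diffs (\<lambda>k. 1 / fact (2 * k)) k = (1 + real k) * 1 / ((1 + real k) * (2 * fact (2 * k + 1)))"
      by (simp only: diffs_def of_nat_Suc times_divide_eq_right ac_simps)
    also have "\<dots> = 1 / (2 * fact (2 * k + 1))" by (rule mult_divide_mult_cancel_left) simp
    finally show ?thesis by (simp del: fact_Suc)
  qed
  then have "(\<Sum>k. diffs (\<lambda>k. 1 / fact (2 * k)) k * y ^ k) = (\<Sum>k. 1 / fact (2 * k + 1) * y ^ k / 2)"
    by (simp del: fact_Suc)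
  also have "\<dots> = sinhc_sqrt y / 2"
    unfolding sinhc_sqrt_def by (rule suminf_divide[OF summable_sinhc_sqrt])
  ultimately show ?thesis by (simp only:)
qed

lemma has_derivative_sinhc_sqrt: "(sinhc_sqrt has_field_derivative sinhc_sqrt' y) (at y)"
  unfolding sinhc_sqrt_def[abs_def] sinhc_sqrt'_def
  by (rule termdiffs_strong_converges_everywhere) (rule summable_sinhc_sqrt)

text \<open>Differentiation of both sides of
  \<open>x * sinhc_sqrt (x\<^sup>2) = sinh x\<close>.\<close>

lemma sinhc_sqrt'_eq:
  "2 * x\<^sup>2 * sinhc_sqrt' (x\<^sup>2) = cosh_sqrt (x\<^sup>2) - sinhc_sqrt (x\<^sup>2)"
proof -
  have "((\<lambda>x. x * sinhc_sqrt (x\<^sup>2)) has_field_derivative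
      (x * (sinhc_sqrt' (x\<^sup>2) * (2 * x)) + sinhc_sqrt (x\<^sup>2))) (at x)"
    by (auto intro!: derivative_eq_intros DERIV_chain2[OF has_derivative_sinhc_sqrt])
  moreover have "((\<lambda>x. x * sinhc_sqrt (x\<^sup>2)) has_field_derivative cosh x) (at x)"
    unfolding sinhc_sqrt_square by (auto intro!: derivative_eq_intros)
  ultimately have "x * (sinhc_sqrt' (x\<^sup>2) * (2 * x)) + sinhc_sqrt (x\<^sup>2) = cosh x"
    by (rule DERIV_unique)
  then show ?thesis unfolding cosh_sqrt_square by (simp add: power2_eq_square algebra_simps)
qed

lemma sinhc_sqrt_nonneg: "0 \<le> y \<Longrightarrow> 0 \<le> sinhc_sqrt y"
  unfolding sinhc_sqrt_def by (intro suminf_nonneg summable_sinhc_sqrt) simp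

lemma sinhc_sqrt_le_cosh_sqrt: "0 \<le> y \<Longrightarrow> sinhc_sqrt y \<le> cosh_sqrt y"
  unfolding sinhc_sqrt_def cosh_sqrt_def
  by (intro suminf_le summable_sinhc_sqrt summable_cosh_sqrt mult_right_mono divide_left_mono fact_mono)
     (auto simp del: fact_Suc)

section \<open>Dissipation inequality\<close>

text \<open>By convexity the graph of an even power lies above its tangent at \<open>a\<close>. For
  nonzero \<open>a\<close> this is Bernoulli's inequality at \<open>c / a\<close>, valid on the
  whole line for even exponents, multiplied by \<open>a ^ q\<close>.\<close>

lemma even_power_tangent:
  fixes a c :: real
  assumes "even q"
  shows "real q * a ^ (q - 1) * (c - a) \<le> c ^ q - a ^ q"
proof (cases "a = 0")
  case True
  \<comment> \<open>Evenness rules out q = 1, so \<open>a ^ (q - 1)\<close> is zero unless q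
    is.\<close>
  have "q = 0 \<or> q \<ge> 2" using assms by presburger
  then show ?thesis using True assms by (auto simp: power_0_left zero_le_even_power)
next
  case False
  have "a ^ q * (1 + real q * (c / a - 1)) \<le> a ^ q * (1 + (c / a - 1)) ^ q"
    using assms by (intro mult_left_mono Bernoulli_inequality_even) (auto simp: zero_le_even_power)
  also have "\<dots> = c ^ q" using False by (simp add: power_divide)
  finally have "a ^ q * (1 + real q * (c / a - 1)) \<le> c ^ q" .
  moreover have "a ^ q * (1 + real q * (c / a - 1)) = a ^ q + real q * a ^ (q - 1) * (c - a)"
  proof (cases q)
    case (Suc p)
    have "a * (c / a - 1) = c - a" using False by (simp add: right_diff_distrib)
    moreover have "a ^ Suc p * (1 + real q * (c / a - 1)) = a ^ Suc p + real q * a ^ p * (a * (c / a - 1))"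
      by (simp only: power_Suc distrib_left mult_1_right ac_simps)
    ultimately have "a ^ Suc p * (1 + real q * (c / a - 1)) = a ^ Suc p + real q * a ^ p * (c - a)"
      by (simp only:)
    then show ?thesis by (simp add: Suc)
  qed simp
  ultimately show ?thesis by simp
qed

text \<open>The tangent at the midpoint is used for both end points, and the linear terms
  cancel.\<close>

lemma even_power_midpoint:
  fixes a c :: real
  assumes "even q"
  shows "((a + c) / 2) ^ q \<le> (a ^ q + c ^ q) / 2"
proof -
  define m where "m = (a + c) / 2"
  have "real q * m ^ (q - 1) * (a - m) + real q * m ^ (q - 1) * (c - m) = 0"
    by (simp add: m_def field_simps)
  with even_power_tangent[OF assms, of m a] even_power_tangent[OF assms, of m c]
  have "2 * m ^ q \<le> a ^ q + c ^ q" by linarith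
  then show ?thesis unfolding m_def by simp
qed

lemma sum_power_synth_shift:
  assumes "n > 0"
  shows "(\<Sum>j\<in>{0..<int n}. synth n C (j + l) ^ q) = (\<Sum>j\<in>{0..<int n}. synth n C j ^ q)"
  using periodic_sum_shift[OF assms, of "\<lambda>j. synth n C j ^ q" l]
  by (simp add: synth_mod[OF assms] add.commute)

lemma sum_power_synth_reflect:
  assumes "n > 0"
  shows "(\<Sum>j\<in>{0..<int n}. synth n C (l - j) ^ q) = (\<Sum>j\<in>{0..<int n}. synth n C j ^ q)"
  using periodic_sum_reflect[OF assms, of "\<lambda>j. synth n C j ^ q" l]
  by (simp add: synth_mod[OF assms])

text \<open>The factor is the mean of the characters for \<open>l\<close> and \<open>- l\<close>,
  and a character multiplying the coefficients translates the function. This is the effect of a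
  rotation together with its inverse.\<close>

lemma synth_cos:
  "synth n (\<lambda>k. of_real (Re (unity_root n (l * k))) * C k) j
    = (synth n C (j + l) + synth n C (j - l)) / 2"
proof -
  have "of_real (Re (unity_root n (l * k))) * C k
     = of_real (1 / 2) * (C k * unity_root n (l * k) + C k * unity_root n (- l * k))" for k
    by (simp add: unity_root_minus complex_add_cnj flip: distrib_left)
  then have "synth n (\<lambda>k. of_real (Re (unity_root n (l * k))) * C k) j
     = synth n (\<lambda>k. of_real (1 / 2) * (C k * unity_root n (l * k) + C k * unity_root n (- l * k))) j"
    by (simp only:)
  also have "\<dots> = (synth n C (j + l) + synth n C (j - l)) / 2"
    unfolding synth_scale synth_add synth_shift by simp
  finally show ?thesis .
qed

text \<open>A real part is the mean of a coefficient and its conjugate, and conjugate coefficients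
  belong to the reflected function. In this way a reflection in the group carries the function on
  the reflections to one on the rotations.\<close>

lemma synth_Re:
  "synth n (\<lambda>k. of_real (Re (unity_root n (l * k) * C k))) j
    = (synth n C (j + l) + synth n C (l - j)) / 2"
proof -
  have "of_real (Re (unity_root n (l * k) * C k))
     = of_real (1 / 2) * (C k * unity_root n (l * k) + cnj (C k) * unity_root n (- l * k))" for k
    using complex_add_cnj[of "C k * unity_root n (l * k)"]
    by (simp add: unity_root_minus mult.commute)
  then have "synth n (\<lambda>k. of_real (Re (unity_root n (l * k) * C k))) j
     = synth n (\<lambda>k. of_real (1 / 2) * (C k * unity_root n (l * k) + cnj (C k) * unity_root n (- l * k))) j"
    by (simp only:)
  also have "\<dots> = (synth n C (j + l) + synth n C (l - j)) / 2"
    unfolding synth_scale synth_add synth_shift synth_cnj by simp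
  finally show ?thesis .
qed

lemma sum_power_average_le:
  fixes u v w :: "int \<Rightarrow> real"
  assumes "even q" and "\<And>j. w j = (u j + v j) / 2"
    and "(\<Sum>j\<in>Z. u j ^ q) = S" "(\<Sum>j\<in>Z. v j ^ q) = S"
  shows "(\<Sum>j\<in>Z. w j ^ q) \<le> S"
proof -
  have "(\<Sum>j\<in>Z. w j ^ q) \<le> (\<Sum>j\<in>Z. (u j ^ q + v j ^ q) / 2)"
    unfolding assms(2) by (intro sum_mono even_power_midpoint assms(1))
  also have "\<dots> = S" using assms(3,4) by (simp add: sum.distrib flip: sum_divide_distrib)
  finally show ?thesis .
qed

text \<open>Up to a factor t, \<open>F1\<close> and \<open>H1\<close> will be the derivatives of the
  modes when the rates move in the direction of \<open>dx\<close> and \<open>dy\<close>; the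
  conclusion says that the sum of q-th powers then has a nonpositive derivative. The bound on
  \<open>K\<close> is what the majorant property takes as input.\<close>

lemma dissipation:
  fixes F :: "int \<Rightarrow> real" and H :: "int \<Rightarrow> complex" and K :: "int \<Rightarrow> int \<Rightarrow> complex"
    and dx dy :: "int \<Rightarrow> real"
  assumes "n > 0" "even q"
    and dx: "\<And>l. l \<in> {0..<int n} \<Longrightarrow> 0 \<le> dx l" and dy: "\<And>l. l \<in> {0..<int n} \<Longrightarrow> 0 \<le> dy l"
    and K: "\<And>l k. l \<in> {0..<int n} \<Longrightarrow> k \<in> {0..<int n} \<Longrightarrow> norm (K l k) \<le> F k"
  defines "F1 \<equiv> \<lambda>k. \<Sum>l\<in>{0..<int n}. dx l * (Re (unity_root n (l * k)) * F k - F k)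
      + dy l * (Re (unity_root n (l * k) * H k) - F k)"
    and "H1 \<equiv> \<lambda>k. \<Sum>l\<in>{0..<int n}. of_real (dx l) * (of_real (Re (unity_root n (l * k))) * H k - H k)
      + of_real (dy l) * (K l k - H k)"
    and "f \<equiv> synth n (\<lambda>k. of_real (F k))" and "h \<equiv> synth n H"
  shows "(\<Sum>j\<in>{0..<int n}. real q * f j ^ (q - 1) * synth n (\<lambda>k. of_real (F1 k)) j
      + real q * h j ^ (q - 1) * synth n H1 j) \<le> 0"
proof -
  let ?Z = "{0..<int n}"
  define v where "v l = synth n (\<lambda>k. of_real (Re (unity_root n (l * k))) * of_real (F k))" for l
  define v' where "v' l = synth n (\<lambda>k. of_real (Re (unity_root n (l * k) * H k)))" for l
  define w where "w l = synth n (\<lambda>k. of_real (Re (unity_root n (l * k))) * H k)" for l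
  define w' where "w' l = synth n (K l)" for l
  have F1: "synth n (\<lambda>k. of_real (F1 k)) j = (\<Sum>l\<in>?Z. dx l * (v l j - f j) + dy l * (v' l j - f j))" for j
  proof -
    have "synth n (\<lambda>k. of_real (F1 k)) j = synth n (\<lambda>k. \<Sum>l\<in>?Z.
        of_real (dx l) * (of_real (Re (unity_root n (l * k))) * of_real (F k) - of_real (F k))
        + of_real (dy l) * (of_real (Re (unity_root n (l * k) * H k)) - of_real (F k))) j"
      unfolding F1_def by simp
    then show ?thesis
      unfolding synth_sum synth_add synth_scale synth_diff v_def v'_def f_def .
  qed
  have H1: "synth n H1 j = (\<Sum>l\<in>?Z. dx l * (w l j - h j) + dy l * (w' l j - h j))" for j
    unfolding H1_def synth_sum synth_add synth_scale synth_diff w_def w'_def h_def ..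
  have tangent: "real q * a ^ (q - 1) * (\<Sum>l\<in>?Z. dx l * (c l - a) + dy l * (c' l - a))
      \<le> (\<Sum>l\<in>?Z. dx l * (c l ^ q - a ^ q) + dy l * (c' l ^ q - a ^ q))" for a c c'
  proof -
    have "real q * a ^ (q - 1) * (\<Sum>l\<in>?Z. dx l * (c l - a) + dy l * (c' l - a))
      = (\<Sum>l\<in>?Z. dx l * (real q * a ^ (q - 1) * (c l - a)) + dy l * (real q * a ^ (q - 1) * (c' l - a)))"
      by (simp add: sum_distrib_left algebra_simps)
    also have "\<dots> \<le> (\<Sum>l\<in>?Z. dx l * (c l ^ q - a ^ q) + dy l * (c' l ^ q - a ^ q))"
      by (intro sum_mono add_mono mult_left_mono even_power_tangent \<open>even q\<close> dx dy)
    finally show ?thesis .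
  qed
  define \<Sigma>f where "\<Sigma>f = (\<Sum>j\<in>?Z. f j ^ q)"
  define \<Sigma>h where "\<Sigma>h = (\<Sum>j\<in>?Z. h j ^ q)"
  have "(\<Sum>j\<in>?Z. real q * f j ^ (q - 1) * synth n (\<lambda>k. of_real (F1 k)) j
      + real q * h j ^ (q - 1) * synth n H1 j)
    \<le> (\<Sum>j\<in>?Z. (\<Sum>l\<in>?Z. dx l * (v l j ^ q - f j ^ q) + dy l * (v' l j ^ q - f j ^ q))
      + (\<Sum>l\<in>?Z. dx l * (w l j ^ q - h j ^ q) + dy l * (w' l j ^ q - h j ^ q)))"
    unfolding F1 H1 by (intro sum_mono add_mono tangent)
  \<comment> \<open>With the sums exchanged, each \<open>l\<close> contributes its weights times a
    change of the total power sum over both halves of the group.\<close>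
  also have "\<dots> = (\<Sum>l\<in>?Z. dx l * ((\<Sum>j\<in>?Z. v l j ^ q) + (\<Sum>j\<in>?Z. w l j ^ q) - (\<Sigma>f + \<Sigma>h))
      + dy l * ((\<Sum>j\<in>?Z. v' l j ^ q) + (\<Sum>j\<in>?Z. w' l j ^ q) - (\<Sigma>f + \<Sigma>h)))"
    unfolding sum.distrib[symmetric] \<Sigma>f_def \<Sigma>h_def
    by (subst sum.swap, rule sum.cong[OF refl])
       (simp add: sum.distrib sum_subtractf algebra_simps sum_distrib_left)
  also have "\<dots> \<le> 0"
  proof (rule sum_nonpos)
    fix l assume l: "l \<in> ?Z"
    have v: "(\<Sum>j\<in>?Z. v l j ^ q) \<le> \<Sigma>f"
      unfolding v_def synth_cos
      by (rule sum_power_average_le[OF \<open>even q\<close> refl])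
         (simp_all add: \<Sigma>f_def f_def sum_power_synth_shift[OF \<open>n > 0\<close>]
           sum_power_synth_shift[OF \<open>n > 0\<close>, of _ "- l", simplified])
    have w: "(\<Sum>j\<in>?Z. w l j ^ q) \<le> \<Sigma>h"
      unfolding w_def synth_cos
      by (rule sum_power_average_le[OF \<open>even q\<close> refl])
         (simp_all add: \<Sigma>h_def h_def sum_power_synth_shift[OF \<open>n > 0\<close>]
           sum_power_synth_shift[OF \<open>n > 0\<close>, of _ "- l", simplified])
    \<comment> \<open>A reflection exchanges the two halves: the new function on the rotations is
      bounded by \<open>\<Sigma>h\<close> and the one on the reflections by
      \<open>\<Sigma>f\<close>.\<close>
    have v': "(\<Sum>j\<in>?Z. v' l j ^ q) \<le> \<Sigma>h"
      unfolding v'_def synth_Re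
      by (rule sum_power_average_le[OF \<open>even q\<close> refl])
         (simp_all add: \<Sigma>h_def h_def sum_power_synth_shift[OF \<open>n > 0\<close>]
           sum_power_synth_reflect[OF \<open>n > 0\<close>])
    have w': "(\<Sum>j\<in>?Z. w' l j ^ q) \<le> \<Sigma>f"
      unfolding w'_def \<Sigma>f_def f_def by (intro synth_majorant \<open>n > 0\<close> K l)
    show "dx l * ((\<Sum>j\<in>?Z. v l j ^ q) + (\<Sum>j\<in>?Z. w l j ^ q) - (\<Sigma>f + \<Sigma>h))
      + dy l * ((\<Sum>j\<in>?Z. v' l j ^ q) + (\<Sum>j\<in>?Z. w' l j ^ q) - (\<Sigma>f + \<Sigma>h)) \<le> 0"
      using v w v' w' by (intro add_nonpos_nonpos mult_nonneg_nonpos dx dy l) auto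
  qed
  finally show ?thesis .
qed

section \<open>Dependence of the Fourier modes on the rates\<close>

text \<open>Diagonal entry of the generator in the two-dimensional representation number
  \<open>k\<close>, with the loss by the total rate included. For symmetric rates the imaginary
  parts cancel, so the real part is taken from the start.\<close>

definition rot_coef :: "nat \<Rightarrow> (int \<Rightarrow> real) \<Rightarrow> (int \<Rightarrow> real) \<Rightarrow> int \<Rightarrow> real" where
  "rot_coef n x y k = (\<Sum>l\<in>{0..<int n}. x l * (Re (unity_root n (l * k)) - 1) - y l)"

text \<open>Off-diagonal entry of the same matrix, to which only the reflections contribute.\<close>

definition refl_coef :: "nat \<Rightarrow> (int \<Rightarrow> real) \<Rightarrow> int \<Rightarrow> complex" where
  "refl_coef n y k = (\<Sum>l\<in>{0..<int n}. of_real (y l) * unity_root n (- l * k))"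

text \<open>The generator is a I + B, where B has zero diagonal and the entries b and its conjugate
  off it, so B^2 = |b|^2 I. Hence its exponential at time t has the diagonal entry exp (t a) cosh (t
  |b|).\<close>

definition diag_entry :: "real \<Rightarrow> real \<Rightarrow> complex \<Rightarrow> real" where
  "diag_entry t a b = exp (t * a) * cosh_sqrt ((t * norm b)\<^sup>2)"

text \<open>The entry exp (t a) sinh (t |b|) b / |b| of the same exponential, in a form without
  division that covers b = 0.\<close>

definition offdiag_entry :: "real \<Rightarrow> real \<Rightarrow> complex \<Rightarrow> complex" where
  "offdiag_entry t a b = of_real (exp (t * a) * t * sinhc_sqrt ((t * norm b)\<^sup>2)) * b"

definition offdiag_deriv :: "real \<Rightarrow> real \<Rightarrow> complex \<Rightarrow> complex \<Rightarrow> complex" where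
  "offdiag_deriv t a b c = of_real (exp (t * a)) * (of_real (sinhc_sqrt ((t * norm b)\<^sup>2)) * c
     + of_real (2 * t\<^sup>2 * sinhc_sqrt' ((t * norm b)\<^sup>2) * Re (cnj c * b)) * b)"

lemma norm_sq_Re_Im: "(t * norm (z::complex))\<^sup>2 = t\<^sup>2 * (Re z * Re z + Im z * Im z)"
  by (simp add: power_mult_distrib cmod_power2) (simp add: power2_eq_square)

lemma has_derivative_norm_sq:
  fixes b c :: complex
  shows "((\<lambda>\<epsilon>. (t * norm (b + of_real \<epsilon> * c))\<^sup>2) has_field_derivative
    2 * t\<^sup>2 * Re (cnj c * (b + of_real e * c))) (at e)"
  unfolding norm_sq_Re_Im by (auto intro!: derivative_eq_intros simp: algebra_simps)

text \<open>The entry is half the trace of exp (t A), and the derivative of this trace is t tr (A'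
  exp (t A)) even if A and A' do not commute. So it is again a combination of entries of the same
  exponential.\<close>

lemma has_derivative_diag_entry:
  fixes b c :: complex and e :: real
  defines "B \<equiv> b + of_real e * c"
  shows "((\<lambda>\<epsilon>. diag_entry t (a + \<epsilon> * a') (b + of_real \<epsilon> * c)) has_field_derivative
    t * (a' * diag_entry t (a + e * a') B + Re (cnj c * offdiag_entry t (a + e * a') B))) (at e)"
proof -
  have 1: "((\<lambda>\<epsilon>. cosh_sqrt ((t * norm (b + of_real \<epsilon> * c))\<^sup>2)) has_field_derivative
      sinhc_sqrt ((t * norm B)\<^sup>2) / 2 * (2 * t\<^sup>2 * Re (cnj c * B))) (at e)"
    unfolding B_def by (rule DERIV_chain2[OF has_derivative_cosh_sqrt has_derivative_norm_sq])
  have 2: "((\<lambda>\<epsilon>. exp (t * (a + \<epsilon> * a'))) has_field_derivative exp (t * (a + e * a')) * (t * a')) (at e)"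
    by (auto intro!: derivative_eq_intros)
  have "((\<lambda>\<epsilon>. diag_entry t (a + \<epsilon> * a') (b + of_real \<epsilon> * c)) has_field_derivative
     exp (t * (a + e * a')) * (t * a') * cosh_sqrt ((t * norm B)\<^sup>2)
     + sinhc_sqrt ((t * norm B)\<^sup>2) / 2 * (2 * t\<^sup>2 * Re (cnj c * B)) * exp (t * (a + e * a'))) (at e)"
    using DERIV_mult[OF 2 1] unfolding diag_entry_def B_def .
  moreover have "Re (cnj c * offdiag_entry t A B)
     = exp (t * A) * t * sinhc_sqrt ((t * norm B)\<^sup>2) * Re (cnj c * B)" for A
    unfolding offdiag_entry_def by (simp add: algebra_simps)
  ultimately show ?thesis
    unfolding B_def[symmetric] diag_entry_def by (simp add: algebra_simps power2_eq_square)
qed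

text \<open>Here the lack of commutation is felt: only the scalar part \<open>a'\<close> factors
  out, and the effect of the direction \<open>c\<close> is collected in
  \<open>offdiag_deriv\<close>.\<close>

lemma has_derivative_offdiag_entry:
  fixes b c :: complex and e :: real
  defines "B \<equiv> b + of_real e * c"
  shows "((\<lambda>\<epsilon>. offdiag_entry t (a + \<epsilon> * a') (b + of_real \<epsilon> * c)) has_vector_derivative
    of_real t * (of_real a' * offdiag_entry t (a + e * a') B + offdiag_deriv t (a + e * a') B c)) (at e)"
proof -
  let ?s = "sinhc_sqrt ((t * norm B)\<^sup>2)" and ?s' = "sinhc_sqrt' ((t * norm B)\<^sup>2)"
  let ?E = "exp (t * (a + e * a'))"
  have "((\<lambda>\<epsilon>. sinhc_sqrt ((t * norm (b + of_real \<epsilon> * c))\<^sup>2)) has_field_derivative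
      ?s' * (2 * t\<^sup>2 * Re (cnj c * B))) (at e)"
    unfolding B_def by (rule DERIV_chain2[OF has_derivative_sinhc_sqrt has_derivative_norm_sq])
  moreover have "((\<lambda>\<epsilon>. exp (t * (a + \<epsilon> * a')) * t) has_field_derivative ?E * (t * a') * t) (at e)"
    by (auto intro!: derivative_eq_intros)
  ultimately have 1: "((\<lambda>\<epsilon>. exp (t * (a + \<epsilon> * a')) * t * sinhc_sqrt ((t * norm (b + of_real \<epsilon> * c))\<^sup>2))
      has_field_derivative
        ?E * (t * a') * t * ?s + ?s' * (2 * t\<^sup>2 * Re (cnj c * B)) * (?E * t)) (at e)"
    unfolding B_def by (intro DERIV_mult)
  have 2: "((\<lambda>\<epsilon>. b + of_real \<epsilon> * c) has_vector_derivative c) (at e)"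
    by (auto intro!: derivative_eq_intros simp: scaleR_conv_of_real[symmetric])
  show ?thesis
    using has_vector_derivative_scaleR[OF 1 2]
    unfolding offdiag_entry_def offdiag_deriv_def B_def[symmetric] scaleR_conv_of_real
    by (rule has_vector_derivative_eq_rhs) (simp add: algebra_simps)
qed

text \<open>This bound feeds the majorant property: up to the factor \<open>t\<close>, \<open>offdiag_deriv t a b c\<close> is the
  derivative of \<open>offdiag_entry t a b\<close> when \<open>b\<close> moves in the direction \<open>c\<close>.\<close>

lemma norm_offdiag_deriv_le:
  assumes "norm c = 1"
  shows "norm (offdiag_deriv t a b c) \<le> diag_entry t a b"
proof -
  let ?y = "(t * norm b)\<^sup>2"
  have s: "0 \<le> sinhc_sqrt ?y" "sinhc_sqrt ?y \<le> cosh_sqrt ?y"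
    by (simp_all add: sinhc_sqrt_nonneg sinhc_sqrt_le_cosh_sqrt)
  \<comment> \<open>Since \<open>Re (cnj c * b)\<close> is at most \<open>norm b\<close> in modulus,
    \<open>sinhc_sqrt'_eq\<close> bounds this term by \<open>cosh_sqrt ?y - sinhc_sqrt ?y\<close>.
    The other term has modulus \<open>sinhc_sqrt ?y\<close>, so together they give exactly
    \<open>cosh_sqrt ?y\<close>.\<close>
  have "norm (of_real (2 * t\<^sup>2 * sinhc_sqrt' ?y * Re (cnj c * b)) * b)
      = \<bar>2 * t\<^sup>2 * sinhc_sqrt' ?y\<bar> * \<bar>Re (cnj c * b)\<bar> * norm b"
    by (simp only: norm_mult norm_of_real abs_mult)
  also have "\<dots> \<le> \<bar>2 * t\<^sup>2 * sinhc_sqrt' ?y\<bar> * norm b * norm b"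
    using abs_Re_le_cmod[of "cnj c * b"] assms
    by (intro mult_right_mono mult_left_mono) (auto simp: norm_mult simp del: times_complex.sel)
  also have "\<dots> = \<bar>2 * ?y * sinhc_sqrt' ?y\<bar>"
    by (simp add: abs_mult power2_eq_square)
  also have "\<dots> = cosh_sqrt ?y - sinhc_sqrt ?y"
    using s unfolding sinhc_sqrt'_eq by simp
  finally have "norm (of_real (2 * t\<^sup>2 * sinhc_sqrt' ?y * Re (cnj c * b)) * b)
      \<le> cosh_sqrt ?y - sinhc_sqrt ?y" .
  moreover have "norm (of_real (sinhc_sqrt ?y) * c) = sinhc_sqrt ?y"
    using s assms by (simp add: norm_mult)
  ultimately have "norm (of_real (sinhc_sqrt ?y) * c + of_real (2 * t\<^sup>2 * sinhc_sqrt' ?y * Re (cnj c * b)) * b)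
      \<le> cosh_sqrt ?y"
    by (intro order_trans[OF norm_triangle_ineq]) linarith
  then show ?thesis
    unfolding offdiag_deriv_def diag_entry_def by (simp add: norm_mult del: times_complex.sel)
qed

text \<open>For real \<open>b\<close> and direction 1 the matrices commute, so the derivative is an
  entry of the exponential itself. This is the situation at frequency 0, where equality allows 1/2
  to be subtracted from both sides of the norm bound.\<close>

lemma offdiag_deriv_real:
  "offdiag_deriv t a (of_real b) 1 = of_real (diag_entry t a (of_real b))"
proof -
  have "2 * t\<^sup>2 * sinhc_sqrt' ((t * b)\<^sup>2) * b * b = cosh_sqrt ((t * b)\<^sup>2) - sinhc_sqrt ((t * b)\<^sup>2)"
    using sinhc_sqrt'_eq[of "t * b"] by (simp add: power2_eq_square algebra_simps)
  moreover have "(t * norm (complex_of_real b))\<^sup>2 = (t * b)\<^sup>2" by (simp add: power_mult_distrib)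
  ultimately show ?thesis
    unfolding offdiag_deriv_def diag_entry_def
    by (simp flip: of_real_mult of_real_add add: algebra_simps)
qed

text \<open>The real part in its definition makes \<open>offdiag_deriv\<close> linear in the
  direction over the reals only, hence the real weights.\<close>

lemma offdiag_deriv_sum:
  "offdiag_deriv t a b (\<Sum>l\<in>L. of_real (r l) * c l) = (\<Sum>l\<in>L. of_real (r l) * offdiag_deriv t a b (c l))"
proof -
  have add: "offdiag_deriv t a b (c + d) = offdiag_deriv t a b c + offdiag_deriv t a b d" for c d
    by (simp add: offdiag_deriv_def algebra_simps)
  have scale: "offdiag_deriv t a b (of_real s * c) = of_real s * offdiag_deriv t a b c" for s c
    by (simp add: offdiag_deriv_def algebra_simps)
  show ?thesis
    by (induction L rule: infinite_finite_induct) (auto simp: add scale, auto simp: offdiag_deriv_def)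
qed

section \<open>Modes and power sums along a segment of rates\<close>

lemma has_derivative_synth:
  assumes "\<And>k. k \<in> {0..<int n} \<Longrightarrow> ((\<lambda>\<epsilon>. C \<epsilon> k) has_vector_derivative D k) (at e)"
  shows "((\<lambda>\<epsilon>. synth n (C \<epsilon>) j) has_field_derivative synth n D j) (at e)"
proof -
  have "((\<lambda>\<epsilon>. \<Sum>k\<in>{0..<int n}. C \<epsilon> k * unity_root n (j * k)) has_vector_derivative
      (\<Sum>k\<in>{0..<int n}. D k * unity_root n (j * k))) (at e)"
    by (intro has_vector_derivative_sum has_vector_derivative_mult_left assms)
  from bounded_linear.has_vector_derivative[OF bounded_linear_Re this]
  have "((\<lambda>\<epsilon>. Re (\<Sum>k\<in>{0..<int n}. C \<epsilon> k * unity_root n (j * k))) has_field_derivative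
      Re (\<Sum>k\<in>{0..<int n}. D k * unity_root n (j * k))) (at e)"
    unfolding has_real_derivative_iff_has_vector_derivative .
  then show ?thesis unfolding synth_def by (rule DERIV_cdivide)
qed

text \<open>Subtracting the uniform distribution affects the modes of frequency 0 only.\<close>

definition rot_mode :: "nat \<Rightarrow> real \<Rightarrow> (int \<Rightarrow> real) \<Rightarrow> (int \<Rightarrow> real) \<Rightarrow> int \<Rightarrow> real" where
  "rot_mode n t x y k =
     diag_entry t (rot_coef n x y k) (refl_coef n y k) - (if k = 0 then 1 / 2 else 0)"

definition refl_mode :: "nat \<Rightarrow> real \<Rightarrow> (int \<Rightarrow> real) \<Rightarrow> (int \<Rightarrow> real) \<Rightarrow> int \<Rightarrow> complex" where
  "refl_mode n t x y k =
     offdiag_entry t (rot_coef n x y k) (refl_coef n y k) - (if k = 0 then 1 / 2 else 0)"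

lemma rot_coef_affine:
  "rot_coef n (\<lambda>l. x l + e * dx l) (\<lambda>l. y l + e * dy l) k = rot_coef n x y k + e * rot_coef n dx dy k"
  by (simp add: rot_coef_def algebra_simps sum.distrib sum_subtractf sum_distrib_left)

lemma refl_coef_affine:
  "refl_coef n (\<lambda>l. y l + e * dy l) k = refl_coef n y k + of_real e * refl_coef n dy k"
  by (simp add: refl_coef_def algebra_simps sum.distrib sum_distrib_left)

lemma refl_coef_0: "refl_coef n y 0 = of_real (\<Sum>l\<in>{0..<int n}. y l)"
  by (simp add: refl_coef_def)

lemma rot_coef_0: "rot_coef n x y 0 = - (\<Sum>l\<in>{0..<int n}. y l)"
  by (simp add: rot_coef_def sum_negf)

text \<open>The rates are joined by a segment, on which the reflection rates stay nonnegative. There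
  the derivative of the power sum is t times the expression in \<open>dissipation\<close>.\<close>

lemma even_power_sum_antimono:
  fixes x y x' y' :: "int \<Rightarrow> real"
  assumes "n > 0" "even q" "t \<ge> 0"
    and y: "\<And>l. l \<in> {0..<int n} \<Longrightarrow> 0 \<le> y l"
    and xx': "\<And>l. l \<in> {0..<int n} \<Longrightarrow> x l \<le> x' l" and yy': "\<And>l. l \<in> {0..<int n} \<Longrightarrow> y l \<le> y' l"
  shows "(\<Sum>j\<in>{0..<int n}. synth n (\<lambda>k. of_real (rot_mode n t x' y' k)) j ^ q
            + synth n (refl_mode n t x' y') j ^ q)
    \<le> (\<Sum>j\<in>{0..<int n}. synth n (\<lambda>k. of_real (rot_mode n t x y k)) j ^ q
            + synth n (refl_mode n t x y) j ^ q)"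
proof -
  let ?Z = "{0..<int n}"
  define dx where "dx l = x' l - x l" for l
  define dy where "dy l = y' l - y l" for l
  define X where "X \<epsilon> = (\<lambda>l. x l + \<epsilon> * dx l)" for \<epsilon>
  define Y where "Y \<epsilon> = (\<lambda>l. y l + \<epsilon> * dy l)" for \<epsilon>
  define F where "F \<epsilon> = rot_mode n t (X \<epsilon>) (Y \<epsilon>)" for \<epsilon>
  define H where "H \<epsilon> = refl_mode n t (X \<epsilon>) (Y \<epsilon>)" for \<epsilon>
  define f where "f \<epsilon> = synth n (\<lambda>k. of_real (F \<epsilon> k))" for \<epsilon>
  define h where "h \<epsilon> = synth n (H \<epsilon>)" for \<epsilon>
  define \<Phi> where "\<Phi> \<epsilon> = (\<Sum>j\<in>?Z. f \<epsilon> j ^ q + h \<epsilon> j ^ q)" for \<epsilon>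
  have "\<Phi> 1 \<le> \<Phi> 0"
  proof (rule DERIV_nonpos_imp_nonincreasing[of 0 1 \<Phi>])
    fix e :: real assume e: "0 \<le> e" "e \<le> 1"
    have Ye: "0 \<le> Y e l" if "l \<in> ?Z" for l
      using y[OF that] yy'[OF that] e by (simp add: Y_def dy_def)
    \<comment> \<open>The constant at frequency 0 is the one in \<open>refl_mode\<close>, so that it
      drops out of \<open>K l k - H e k\<close>.\<close>
    define K where "K l k = offdiag_deriv t (rot_coef n (X e) (Y e) k) (refl_coef n (Y e) k)
        (unity_root n (- l * k)) - (if k = 0 then 1 / 2 else 0)" for l k
    define F1 where "F1 k = (\<Sum>l\<in>?Z. dx l * (Re (unity_root n (l * k)) * F e k - F e k)
      + dy l * (Re (unity_root n (l * k) * H e k) - F e k))" for k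
    define H1 where "H1 k = (\<Sum>l\<in>?Z. of_real (dx l) * (of_real (Re (unity_root n (l * k))) * H e k - H e k)
      + of_real (dy l) * (K l k - H e k))" for k
    \<comment> \<open>Frequency 0 needs its own argument, as 1/2 is subtracted from
      \<open>diag_entry\<close> there. What remains is exp (- 2 t b) / 2 for the total reflection
      rate b, and \<open>K\<close> has the same value.\<close>
    have F0: "F e 0 \<ge> 0" and K0: "K l 0 = of_real (F e 0)" for l
    proof -
      let ?b = "\<Sum>l\<in>?Z. Y e l"
      have "diag_entry t (- ?b) (of_real ?b) = exp (- (t * ?b)) * cosh (t * ?b)"
        using Ye by (simp add: diag_entry_def cosh_sqrt_square sum_nonneg del: of_real_sum)
      also have "\<dots> = (1 + exp (- 2 * (t * ?b))) / 2"
        by (simp add: cosh_def algebra_simps flip: exp_add)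
      also have "\<dots> \<ge> 1 / 2" by simp
      finally show "F e 0 \<ge> 0"
        unfolding F_def rot_mode_def rot_coef_0 refl_coef_0 by simp
      show "K l 0 = of_real (F e 0)"
        unfolding F_def rot_mode_def K_def rot_coef_0 refl_coef_0 mult_zero_right unity_root_0
          offdiag_deriv_real by simp
    qed
    have norm_K: "norm (K l k) \<le> F e k" for l k
    proof (cases "k = 0")
      case True
      then show ?thesis using F0 K0 by simp
    next
      case False
      then show ?thesis unfolding K_def F_def rot_mode_def by (simp add: norm_offdiag_deriv_le)
    qed
    have dF: "((\<lambda>\<epsilon>. F \<epsilon> k) has_field_derivative t * F1 k) (at e)" for k
    proof -
      let ?A = "rot_coef n (X e) (Y e) k" and ?B = "refl_coef n (Y e) k"
      have "((\<lambda>\<epsilon>. F \<epsilon> k) has_field_derivative t * (rot_coef n dx dy k * diag_entry t ?A ?B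
         + Re (cnj (refl_coef n dy k) * offdiag_entry t ?A ?B)) - 0) (at e)"
        unfolding F_def rot_mode_def X_def Y_def rot_coef_affine refl_coef_affine
        by (intro DERIV_diff has_derivative_diag_entry DERIV_const)
      moreover have "rot_coef n dx dy k * diag_entry t ?A ?B + Re (cnj (refl_coef n dy k) * offdiag_entry t ?A ?B)
        = F1 k"
      proof -
        have "Re (cnj (refl_coef n dy k) * offdiag_entry t ?A ?B)
            = (\<Sum>l\<in>?Z. dy l * Re (unity_root n (l * k) * offdiag_entry t ?A ?B))"
          unfolding refl_coef_def[of _ dy] cnj_sum sum_distrib_right Re_sum complex_cnj_mult
          by (simp add: unity_root_minus mult.assoc del: times_complex.sel) (simp add: algebra_simps)
        then have "rot_coef n dx dy k * diag_entry t ?A ?B + Re (cnj (refl_coef n dy k) * offdiag_entry t ?A ?B)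
          = (\<Sum>l\<in>?Z. (dx l * (Re (unity_root n (l * k)) - 1) - dy l) * diag_entry t ?A ?B
             + dy l * Re (unity_root n (l * k) * offdiag_entry t ?A ?B))"
          by (simp add: rot_coef_def[of _ dx] sum_distrib_right sum.distrib)
        \<comment> \<open>The constants at frequency 0 cancel because all characters equal 1
          there.\<close>
        also have "\<dots> = F1 k"
          unfolding F1_def F_def H_def rot_mode_def refl_mode_def
          by (intro sum.cong refl) (simp add: algebra_simps)
        finally show ?thesis .
      qed
      ultimately show ?thesis by simp
    qed
    have dH: "((\<lambda>\<epsilon>. H \<epsilon> k) has_vector_derivative of_real t * H1 k) (at e)" for k
    proof -
      let ?A = "rot_coef n (X e) (Y e) k" and ?B = "refl_coef n (Y e) k"
      have "((\<lambda>\<epsilon>. H \<epsilon> k) has_vector_derivative of_real t * (of_real (rot_coef n dx dy k) * offdiag_entry t ?A ?B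
         + offdiag_deriv t ?A ?B (refl_coef n dy k)) - 0) (at e)"
        unfolding H_def refl_mode_def X_def Y_def rot_coef_affine refl_coef_affine
        by (intro has_vector_derivative_diff has_derivative_offdiag_entry has_vector_derivative_const)
      moreover have "of_real (rot_coef n dx dy k) * offdiag_entry t ?A ?B
         + offdiag_deriv t ?A ?B (refl_coef n dy k) = H1 k"
      proof -
        have "of_real (rot_coef n dx dy k) * offdiag_entry t ?A ?B + offdiag_deriv t ?A ?B (refl_coef n dy k)
          = (\<Sum>l\<in>?Z. (of_real (dx l) * (of_real (Re (unity_root n (l * k))) - 1) - of_real (dy l)) * offdiag_entry t ?A ?B
             + of_real (dy l) * offdiag_deriv t ?A ?B (unity_root n (- l * k)))"
          unfolding refl_coef_def[of _ dy] offdiag_deriv_sum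
          by (simp add: rot_coef_def[of _ dx] sum_distrib_right sum.distrib)
        also have "\<dots> = H1 k"
          unfolding H1_def H_def K_def refl_mode_def
          by (intro sum.cong refl) (simp add: algebra_simps)
        finally show ?thesis .
      qed
      ultimately show ?thesis by simp
    qed
    have df: "((\<lambda>\<epsilon>. f \<epsilon> j) has_field_derivative t * synth n (\<lambda>k. of_real (F1 k)) j) (at e)" for j
      unfolding f_def synth_scale[symmetric]
      by (intro has_derivative_synth) (use has_vector_derivative_of_real[OF dF] in simp)
    have dh: "((\<lambda>\<epsilon>. h \<epsilon> j) has_field_derivative t * synth n H1 j) (at e)" for j
      unfolding h_def synth_scale[symmetric] by (intro has_derivative_synth dH)
    have D: "(\<Phi> has_field_derivative (\<Sum>j\<in>?Z.
         real q * f e j ^ (q - 1) * (t * synth n (\<lambda>k. of_real (F1 k)) j)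
       + real q * h e j ^ (q - 1) * (t * synth n H1 j))) (at e)"
      unfolding \<Phi>_def[abs_def]
      by (intro DERIV_sum DERIV_add) (auto intro!: derivative_eq_intros df dh)
    have eq: "(\<Sum>j\<in>?Z. real q * f e j ^ (q - 1) * (t * synth n (\<lambda>k. of_real (F1 k)) j)
       + real q * h e j ^ (q - 1) * (t * synth n H1 j))
      = t * (\<Sum>j\<in>?Z. real q * f e j ^ (q - 1) * synth n (\<lambda>k. of_real (F1 k)) j
       + real q * h e j ^ (q - 1) * synth n H1 j)"
      by (simp add: sum_distrib_left algebra_simps)
    have le: "t * (\<Sum>j\<in>?Z. real q * f e j ^ (q - 1) * synth n (\<lambda>k. of_real (F1 k)) j
       + real q * h e j ^ (q - 1) * synth n H1 j) \<le> 0"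
      using xx' yy' \<open>t \<ge> 0\<close> unfolding f_def h_def F1_def[abs_def] H1_def[abs_def]
      by (intro mult_nonneg_nonpos dissipation \<open>n > 0\<close> \<open>even q\<close> norm_K) (auto simp: dx_def dy_def)
    show "\<exists>d. (\<Phi> has_field_derivative d) (at e) \<and> d \<le> 0"
      using D[unfolded eq] le by (intro exI conjI)
  qed simp
  moreover have "X 0 = x" "Y 0 = y" "X 1 = x'" "Y 1 = y'"
    by (auto simp: X_def Y_def dx_def dy_def)
  ultimately show ?thesis unfolding \<Phi>_def f_def h_def F_def H_def by simp
qed

section \<open>The law of the walk as a limit\<close>

text \<open>This is (I + h A)^k applied to the point mass at the identity, where A is the jump
  operator without its loss term. For h = t / k it approximates exp (t A).\<close>

primrec walk_weight :: "('a, 'b) monoid_scheme \<Rightarrow> ('a \<Rightarrow> real) \<Rightarrow> real \<Rightarrow> nat \<Rightarrow> 'a \<Rightarrow> real" where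
  "walk_weight G lam h 0 g = (if g = \<one>\<^bsub>G\<^esub> then 1 else 0)"
| "walk_weight G lam h (Suc k) g = walk_weight G lam h k g
     + h * (\<Sum>s\<in>carrier G. lam s * walk_weight G lam h k (g \<otimes>\<^bsub>G\<^esub> inv\<^bsub>G\<^esub> s))"

text \<open>Translations preserve total mass, so each step multiplies it by 1 + h L, with L the
  total rate.\<close>

lemma (in group) sum_walk_weight:
  assumes "finite (carrier G)"
  shows "(\<Sum>g\<in>carrier G. walk_weight G lam h k g) = (1 + h * (\<Sum>s\<in>carrier G. lam s)) ^ k"
proof (induction k)
  case 0
  then show ?case using assms by simp
next
  case (Suc k)
  let ?w = "walk_weight G lam h"
  have shift: "(\<Sum>g\<in>carrier G. ?w k (g \<otimes> inv s)) = (\<Sum>g\<in>carrier G. ?w k g)" if "s \<in> carrier G" for s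
    by (rule sum.reindex_bij_witness[where i = "\<lambda>g. g \<otimes> s" and j = "\<lambda>g. g \<otimes> inv s"])
       (use that in \<open>auto simp: m_assoc\<close>)
  have "(\<Sum>g\<in>carrier G. ?w (Suc k) g) = (\<Sum>g\<in>carrier G. ?w k g)
      + h * (\<Sum>s\<in>carrier G. lam s * (\<Sum>g\<in>carrier G. ?w k (g \<otimes> inv s)))"
  proof -
    have "(\<Sum>g\<in>carrier G. \<Sum>s\<in>carrier G. lam s * ?w k (g \<otimes> inv s))
        = (\<Sum>s\<in>carrier G. \<Sum>g\<in>carrier G. lam s * ?w k (g \<otimes> inv s))" by (rule sum.swap)
    then show ?thesis by (simp add: sum.distrib flip: sum_distrib_left)
  qed
  also have "\<dots> = (\<Sum>g\<in>carrier G. ?w k g) + h * (\<Sum>s\<in>carrier G. lam s * (\<Sum>g\<in>carrier G. ?w k g))"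
    by (simp add: shift cong: sum.cong)
  finally show ?case
    using Suc.IH by (simp add: algebra_simps flip: sum_distrib_left sum_distrib_right)
qed

text \<open>A word prescribes for every interval of a time grid either no ring at all (\<open>None\<close>)
  or a single ring.\<close>

primrec word_prod :: "('a, 'b) monoid_scheme \<Rightarrow> (nat \<Rightarrow> 'a option) \<Rightarrow> nat \<Rightarrow> 'a" where
  "word_prod G \<sigma> 0 = \<one>\<^bsub>G\<^esub>"
| "word_prod G \<sigma> (Suc k) =
     (case \<sigma> k of None \<Rightarrow> word_prod G \<sigma> k | Some s \<Rightarrow> word_prod G \<sigma> k \<otimes>\<^bsub>G\<^esub> s)"

definition words :: "('a, 'b) monoid_scheme \<Rightarrow> nat \<Rightarrow> (nat \<Rightarrow> 'a option) set" where
  "words G k = PiE {..<k} (\<lambda>_. insert None (Some ` carrier G))"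

text \<open>Up to the common factor exp (- h L), with L the total rate, this is the probability that
  the clocks behave as the letter says during a time interval of length h.\<close>

definition letter_weight :: "('a \<Rightarrow> real) \<Rightarrow> real \<Rightarrow> 'a option \<Rightarrow> real" where
  "letter_weight lam h x = (case x of None \<Rightarrow> 1 | Some s \<Rightarrow> h * lam s)"

lemma letter_weight_simps:
  "letter_weight lam h None = 1" "letter_weight lam h (Some s) = h * lam s"
  by (simp_all add: letter_weight_def)

lemma word_prod_cong: "(\<And>i. i < k \<Longrightarrow> \<sigma> i = \<tau> i) \<Longrightarrow> word_prod G \<sigma> k = word_prod G \<tau> k"
  by (induction k) (auto split: option.splits)

lemma (in group) word_prod_closed: "\<sigma> \<in> words G k \<Longrightarrow> i \<le> k \<Longrightarrow> word_prod G \<sigma> i \<in> carrier G"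
proof (induction i)
  case (Suc i)
  then have "\<sigma> i \<in> insert None (Some ` carrier G)" by (auto simp: words_def PiE_iff)
  with Suc show ?case by auto
qed simp

lemma finite_words: "finite (carrier G) \<Longrightarrow> finite (words G k)"
  by (simp add: words_def finite_PiE)

text \<open>Expansion of (I + h A)^k: each factor contributes the identity, which is the letter
  \<open>None\<close>, or one jump. The induction splits off the last letter.\<close>

lemma (in group) sum_words:
  assumes "finite (carrier G)" "g \<in> carrier G"
  shows "(\<Sum>\<sigma> | \<sigma> \<in> words G k \<and> word_prod G \<sigma> k = g. \<Prod>i<k. letter_weight lam h (\<sigma> i))
    = walk_weight G lam h k g"
  using assms(2)
proof (induction k arbitrary: g)
  case 0
  have "{\<sigma>. \<sigma> \<in> words G 0 \<and> word_prod G \<sigma> 0 = g} = (if g = \<one> then {\<lambda>_. undefined} else {})"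
    by (auto simp: words_def)
  then show ?case by simp
next
  case (Suc k)
  let ?O = "insert None (Some ` carrier G)"
  let ?\<omega> = "\<lambda>k \<sigma>. \<Prod>i<k. letter_weight lam h (\<sigma> i)"
  let ?S = "\<lambda>k g. \<Sum>\<sigma>\<in>words G k. if word_prod G \<sigma> k = g then ?\<omega> k \<sigma> else 0"
  have S: "(\<Sum>\<sigma> | \<sigma> \<in> words G k \<and> word_prod G \<sigma> k = g. ?\<omega> k \<sigma>) = ?S k g" for k g
    using finite_words[OF assms(1), of k] by (simp add: sum.If_cases Int_def)
  have split: "words G (Suc k) = (\<lambda>(x, \<sigma>). \<sigma>(k := x)) ` (?O \<times> words G k)"
    unfolding words_def lessThan_Suc PiE_insert_eq ..
  have inj: "inj_on (\<lambda>(x, \<sigma>). \<sigma>(k := x)) (?O \<times> words G k)"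
    unfolding words_def by (rule inj_combinator) simp
  have upd: "word_prod G (\<sigma>(k := x)) k = word_prod G \<sigma> k" "?\<omega> k (\<sigma>(k := x)) = ?\<omega> k \<sigma>" for x \<sigma>
    by (auto intro!: word_prod_cong)
  then have upd_Suc: "?\<omega> (Suc k) (\<sigma>(k := x)) = ?\<omega> k \<sigma> * letter_weight lam h x" for x \<sigma>
    unfolding prod.lessThan_Suc by simp
  have O: "(\<Sum>x\<in>?O. \<phi> x) = \<phi> None + (\<Sum>s\<in>carrier G. \<phi> (Some s))" for \<phi> :: "'a option \<Rightarrow> real"
    using assms(1) by (subst sum.insert) (auto simp: sum.reindex)
  have "?S (Suc k) g = (\<Sum>x\<in>?O. \<Sum>\<sigma>\<in>words G k.
      if word_prod G (\<sigma>(k := x)) (Suc k) = g then ?\<omega> (Suc k) (\<sigma>(k := x)) else 0)"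
    unfolding split sum.reindex[OF inj] by (simp add: sum.cartesian_product case_prod_unfold)
  also have "\<dots> = (\<Sum>\<sigma>\<in>words G k. if word_prod G \<sigma> k = g then ?\<omega> k \<sigma> else 0)
      + (\<Sum>s\<in>carrier G. \<Sum>\<sigma>\<in>words G k. if word_prod G \<sigma> k \<otimes> s = g then ?\<omega> k \<sigma> * (h * lam s) else 0)"
    unfolding O upd_Suc upd(1) word_prod.simps fun_upd_same option.case
      letter_weight_simps mult_1_right ..
  also have "(\<Sum>s\<in>carrier G. \<Sum>\<sigma>\<in>words G k. if word_prod G \<sigma> k \<otimes> s = g then ?\<omega> k \<sigma> * (h * lam s) else 0)
      = (\<Sum>s\<in>carrier G. h * (lam s * ?S k (g \<otimes> inv s)))"
  proof (intro sum.cong refl)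
    fix s assume s: "s \<in> carrier G"
    have "word_prod G \<sigma> k \<otimes> s = g \<longleftrightarrow> word_prod G \<sigma> k = g \<otimes> inv s" if "\<sigma> \<in> words G k" for \<sigma>
      using s Suc.prems word_prod_closed[OF that order_refl] by (metis inv_solve_right)
    then show "(\<Sum>\<sigma>\<in>words G k. if word_prod G \<sigma> k \<otimes> s = g then ?\<omega> k \<sigma> * (h * lam s) else 0)
        = h * (lam s * ?S k (g \<otimes> inv s))"
      by (auto simp: sum_distrib_left intro!: sum.cong)
  qed
  also have "\<dots> = h * (\<Sum>s\<in>carrier G. lam s * walk_weight G lam h k (g \<otimes> inv s))"
    using Suc.prems by (simp add: Suc.IH[unfolded S] sum_distrib_left)
  also have "?S k g = walk_weight G lam h k g" using Suc.IH[unfolded S] Suc.prems by simp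
  finally show ?case unfolding S by simp
qed

section \<open>Discretization of the clocks in time\<close>

context random_walk
begin

definition ring_count :: "(nat \<Rightarrow> 'a option) \<Rightarrow> 'a \<Rightarrow> nat \<Rightarrow> nat" where
  "ring_count \<sigma> s i = (if \<sigma> i = Some s then 1 else 0)"

text \<open>All clock increments on the grid are prescribed, so the probability is a product over
  clocks and intervals; and as no interval gets more than one ring, the walk is determined at the
  grid points.\<close>

definition word_event :: "real \<Rightarrow> nat \<Rightarrow> (nat \<Rightarrow> 'a option) \<Rightarrow> 'w set" where
  "word_event h k \<sigma> = {\<omega> \<in> space M. \<forall>s\<in>carrier G. \<forall>i<k.
     N s (real (Suc i) * h) \<omega> - N s (real i * h) \<omega> = ring_count \<sigma> s i}"

lemma carrier_nonempty: "carrier G \<noteq> {}"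
  using one_closed by blast

lemma word_event_walk:
  assumes "0 \<le> h" "\<sigma> \<in> words G k" "\<omega> \<in> word_event h k \<sigma>" "i \<le> k"
  shows "X (real i * h) \<omega> = word_prod G \<sigma> i"
  using \<open>i \<le> k\<close>
proof (induction i)
  case 0
  then show ?case using assms by (simp add: walk_start word_event_def)
next
  case (Suc i)
  have \<omega>: "\<omega> \<in> space M" using assms by (simp add: word_event_def)
  have le: "0 \<le> real i * h" "real i * h \<le> real (Suc i) * h"
    using \<open>0 \<le> h\<close> by (auto intro: mult_right_mono)
  have N: "N s (real (Suc i) * h) \<omega> = N s (real i * h) \<omega> + ring_count \<sigma> s i" if s: "s \<in> carrier G" for s
  proof -
    interpret poisson_process M "lam s" "N s" by (rule poisson_clocks[OF s])
    \<comment> \<open>Subtraction of natural numbers truncates, so monotonicity is needed to recover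
      the count at the end of the interval from the difference.\<close>
    have "N s (real i * h) \<omega> \<le> N s (real (Suc i) * h) \<omega>"
      by (rule mono_onD[OF count_mono[OF \<omega>]])
         (use le in \<open>auto simp del: of_nat_Suc intro: order_trans\<close>)
    moreover have "N s (real (Suc i) * h) \<omega> - N s (real i * h) \<omega> = ring_count \<sigma> s i"
      using assms(3) s Suc.prems by (auto simp: word_event_def)
    ultimately show ?thesis by linarith
  qed
  have IH: "X (real i * h) \<omega> = word_prod G \<sigma> i" using Suc by simp
  show ?case
  proof (cases "\<sigma> i")
    case None
    then have "X (real (Suc i) * h) \<omega> = X (real i * h) \<omega>"
      by (intro walk_no_ring \<omega> le) (auto simp: N ring_count_def simp del: of_nat_Suc)
    then show ?thesis using IH None by simp
  next
    case (Some s)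
    moreover have "\<sigma> i \<in> insert None (Some ` carrier G)"
      using assms(2) Suc.prems by (auto simp: words_def PiE_iff)
    then have "s \<in> carrier G" using Some by auto
    ultimately have "X (real (Suc i) * h) \<omega> = X (real i * h) \<omega> \<otimes> s"
      by (intro walk_one_ring \<omega> le) (auto simp: N ring_count_def simp del: of_nat_Suc)
    then show ?thesis using IH Some by simp
  qed
qed

lemma prob_increments:
  assumes s: "s \<in> carrier G" and "0 \<le> h" "0 < k"
  shows "prob {\<omega> \<in> space M. \<forall>i<k. N s (real (Suc i) * h) \<omega> - N s (real i * h) \<omega> = c i}
    = (\<Prod>i<k. (lam s * h) ^ c i / fact (c i) * exp (- (lam s * h)))"
proof -
  interpret P: poisson_process M "lam s" "N s" by (rule poisson_clocks[OF s])
  let ?D = "\<lambda>i \<omega>. N s (real (Suc i) * h) \<omega> - N s (real i * h) \<omega>"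
  have le: "0 \<le> real i * h" "real i * h \<le> real (Suc i) * h" for i
    using \<open>0 \<le> h\<close> by (auto intro: mult_right_mono)
  have "indep_vars (\<lambda>_. count_space UNIV) ?D {..<k}"
    by (rule P.independent_increments[of "\<lambda>i. real i * h"]) (use le in \<open>simp_all del: of_nat_Suc\<close>)
  from indep_varsD[OF this, of "{..<k}" "\<lambda>i. {c i}"] \<open>0 < k\<close>
  have "prob (\<Inter>i\<in>{..<k}. ?D i -` {c i} \<inter> space M) = (\<Prod>i<k. prob (?D i -` {c i} \<inter> space M))"
    by auto
  moreover have "(\<Inter>i\<in>{..<k}. ?D i -` {c i} \<inter> space M) = {\<omega> \<in> space M. \<forall>i<k. ?D i \<omega> = c i}"
    using \<open>0 < k\<close> by auto
  moreover have "prob (?D i -` {c i} \<inter> space M) = (lam s * h) ^ c i / fact (c i) * exp (- (lam s * h))" for i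
  proof -
    have "?D i -` {c i} \<inter> space M = {\<omega> \<in> space M. ?D i \<omega> = c i}" by auto
    moreover have "real (Suc i) * h - real i * h = h" by (simp add: algebra_simps)
    ultimately show ?thesis using P.poisson_increments[OF le, of i "c i"] by simp
  qed
  ultimately show ?thesis by simp
qed

text \<open>Independence of the clocks as processes gives a product over the clocks, and
  independence of increments a further product over the intervals within one clock.\<close>

lemma prob_word_event:
  assumes \<sigma>: "\<sigma> \<in> words G k" and h: "0 \<le> h" and k: "0 < k"
  shows "word_event h k \<sigma> \<in> events"
    and "prob (word_event h k \<sigma>)
      = exp (- (\<Sum>s\<in>carrier G. lam s) * h) ^ k * (\<Prod>i<k. letter_weight lam h (\<sigma> i))"
proof -
  let ?P = "PiM {0::real..} (\<lambda>_. count_space (UNIV :: nat set))"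
  let ?Y = "\<lambda>s \<omega>. \<lambda>t\<in>{0::real..}. N s t \<omega>"
  \<comment> \<open>A cylinder set: it constrains the paths at finitely many times, hence is
    measurable in the product space.\<close>
  define A where "A s = {x \<in> space ?P. \<forall>i\<in>{..<k}. x (real (Suc i) * h) - x (real i * h) = ring_count \<sigma> s i}" for s
  have ge0: "real i * h \<in> {0..}" for i using h by simp
  have A: "A s \<in> sets ?P" for s
  proof -
    have "{x \<in> space ?P. x (real (Suc i) * h) - x (real i * h) = ring_count \<sigma> s i} \<in> sets ?P" for i
    proof -
      have c: "(\<lambda>x. x (real j * h)) \<in> measurable ?P (count_space UNIV)" for j
        by (rule measurable_component_singleton[OF ge0])
      have "(\<lambda>x. x (real (Suc i) * h) - x (real i * h)) \<in> measurable ?P (count_space UNIV)"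
        by (rule measurable_compose_countable[OF _ c[of "Suc i"], of "\<lambda>a x. a - x (real i * h)"])
           (rule measurable_compose[OF c[of i]], simp)
      from measurable_sets[OF this, of "{ring_count \<sigma> s i}"] show ?thesis
        by (simp add: vimage_def Int_def conj_commute)
    qed
    then show ?thesis unfolding A_def by (intro sets.sets_Collect_finite_All') (use k in auto)
  qed
  have vim: "?Y s -` A s \<inter> space M
      = {\<omega> \<in> space M. \<forall>i<k. N s (real (Suc i) * h) \<omega> - N s (real i * h) \<omega> = ring_count \<sigma> s i}" for s
    using ge0[of "Suc _"] ge0 by (auto simp: A_def space_PiM PiE_iff)
  have rv: "?Y s \<in> measurable M ?P" if "s \<in> carrier G" for s
    using independent_clocks that unfolding indep_vars_def by auto
  have event: "word_event h k \<sigma> = (\<Inter>s\<in>carrier G. ?Y s -` A s \<inter> space M)"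
    unfolding vim word_event_def using carrier_nonempty by auto
  show "word_event h k \<sigma> \<in> events"
    unfolding event using A rv carrier_nonempty finite_group
    by (intro sets.finite_INT measurable_sets) auto
  have "prob (word_event h k \<sigma>) = (\<Prod>s\<in>carrier G. prob (?Y s -` A s \<inter> space M))"
    unfolding event
    by (rule indep_varsD[OF independent_clocks]) (use A carrier_nonempty finite_group in auto)
  also have "\<dots> = (\<Prod>s\<in>carrier G. \<Prod>i<k. (lam s * h) ^ ring_count \<sigma> s i / fact (ring_count \<sigma> s i)
      * exp (- (lam s * h)))"
    unfolding vim by (intro prod.cong refl prob_increments h k)
  also have "\<dots> = (\<Prod>i<k. \<Prod>s\<in>carrier G. (lam s * h) ^ ring_count \<sigma> s i / fact (ring_count \<sigma> s i)
      * exp (- (lam s * h)))"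
    by (rule prod.swap)
  \<comment> \<open>Counts are 0 or 1, so all factorials are 1 and at most one clock per interval
    contributes \<open>lam s * h\<close>.\<close>
  also have "\<dots> = (\<Prod>i<k. \<Prod>s\<in>carrier G. (if \<sigma> i = Some s then lam s * h else 1) * exp (- (lam s * h)))"
    by (intro prod.cong refl) (simp add: ring_count_def)
  also have "\<dots> = (\<Prod>i<k. exp (- (\<Sum>s\<in>carrier G. lam s) * h) * letter_weight lam h (\<sigma> i))"
  proof (intro prod.cong refl)
    fix i assume "i \<in> {..<k}"
    then have "\<sigma> i \<in> insert None (Some ` carrier G)" using \<sigma> by (auto simp: words_def PiE_iff)
    then have "(\<Prod>s\<in>carrier G. if \<sigma> i = Some s then lam s * h else 1) = letter_weight lam h (\<sigma> i)"
      using finite_group by (auto simp: letter_weight_def mult.commute)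
    then show "(\<Prod>s\<in>carrier G. (if \<sigma> i = Some s then lam s * h else 1) * exp (- (lam s * h)))
        = exp (- (\<Sum>s\<in>carrier G. lam s) * h) * letter_weight lam h (\<sigma> i)"
      using finite_group by (simp add: prod.distrib sum_distrib_right sum_negf flip: exp_sum)
  qed
  finally show "prob (word_event h k \<sigma>)
      = exp (- (\<Sum>s\<in>carrier G. lam s) * h) ^ k * (\<Prod>i<k. letter_weight lam h (\<sigma> i))"
    by (simp add: prod.distrib)
qed

lemma word_events_disjoint: "disjoint_family_on (word_event h k) (words G k)"
proof (unfold disjoint_family_on_def, intro ballI impI)
  fix \<sigma> \<tau> assume \<sigma>\<tau>: "\<sigma> \<in> words G k" "\<tau> \<in> words G k" "\<sigma> \<noteq> \<tau>"
  then obtain i where i: "i < k" "\<sigma> i \<noteq> \<tau> i"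
    unfolding words_def by (metis PiE_ext lessThan_iff)
  have "\<sigma> i \<in> insert None (Some ` carrier G)" "\<tau> i \<in> insert None (Some ` carrier G)"
    using \<sigma>\<tau> i by (auto simp: words_def PiE_iff)
  then obtain s where "s \<in> carrier G" "ring_count \<sigma> s i \<noteq> ring_count \<tau> s i"
    using i unfolding ring_count_def by (cases "\<sigma> i"; cases "\<tau> i") auto
  then show "word_event h k \<sigma> \<inter> word_event h k \<tau> = {}"
    using i by (auto simp: word_event_def)
qed

text \<open>The events of the words with product \<open>g\<close> are disjoint, and the walk ends in
  \<open>g\<close> on each of them. Only an inequality results, because several rings in one grid
  interval are left out.\<close>

lemma walk_prob_ge:
  assumes g: "g \<in> carrier G" and h: "0 \<le> h" and k: "0 < k"
  shows "exp (- (\<Sum>s\<in>carrier G. lam s) * h) ^ k * walk_weight G lam h k g \<le> walk_prob M X (real k * h) g"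
proof -
  let ?V = "{\<sigma>. \<sigma> \<in> words G k \<and> word_prod G \<sigma> k = g}"
  have fin: "finite ?V" using finite_words[OF finite_group, of k] by simp
  have X: "{\<omega> \<in> space M. X (real k * h) \<omega> = g} \<in> events"
    using measurable_sets[OF random_variable_walk[of "real k * h"], of "{g}"] g h
    by (simp add: vimage_def Int_def conj_commute)
  have "exp (- (\<Sum>s\<in>carrier G. lam s) * h) ^ k * walk_weight G lam h k g = (\<Sum>\<sigma>\<in>?V. prob (word_event h k \<sigma>))"
    by (simp add: sum_words[OF finite_group g, symmetric] sum_distrib_left prob_word_event(2)[OF _ h k])
  also have "\<dots> = prob (\<Union>\<sigma>\<in>?V. word_event h k \<sigma>)"
    by (rule finite_measure_finite_Union[symmetric, OF fin])
       (auto intro: prob_word_event(1)[OF _ h k] disjoint_family_on_mono[OF _ word_events_disjoint])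
  also have "\<dots> \<le> prob {\<omega> \<in> space M. X (real k * h) \<omega> = g}"
    by (intro finite_measure_mono X)
       (use h in \<open>auto simp: word_event_walk, simp add: word_event_def\<close>)
  finally show ?thesis unfolding walk_prob_def .
qed

lemma sum_walk_prob:
  assumes "0 \<le> t"
  shows "(\<Sum>g\<in>carrier G. walk_prob M X t g) = 1"
proof -
  have X: "X t \<in> measurable M (count_space (carrier G))" by (rule random_variable_walk[OF assms])
  have ev: "{\<omega> \<in> space M. X t \<omega> = g} \<in> events" if "g \<in> carrier G" for g
    using measurable_sets[OF X, of "{g}"] that by (simp add: vimage_def Int_def conj_commute)
  have "(\<Sum>g\<in>carrier G. walk_prob M X t g) = prob (\<Union>g\<in>carrier G. {\<omega> \<in> space M. X t \<omega> = g})"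
    unfolding walk_prob_def
    by (rule finite_measure_finite_Union[symmetric, OF finite_group])
       (auto simp: disjoint_family_on_def ev)
  also have "(\<Union>g\<in>carrier G. {\<omega> \<in> space M. X t \<omega> = g}) = space M"
    using measurable_space[OF X] by auto
  finally show ?thesis by (simp add: prob_space)
qed

text \<open>The lower bounds of \<open>walk_prob_ge\<close> have total mass tending to 1, hence they are
  asymptotically sharp.\<close>

lemma walk_prob_limit:
  assumes "0 \<le> t" "g \<in> carrier G"
  defines "L \<equiv> \<Sum>s\<in>carrier G. lam s"
  shows "(\<lambda>k. exp (- L * t) * walk_weight G lam (t / real k) k g) \<longlonglongrightarrow> walk_prob M X t g"
proof -
  let ?w = "\<lambda>k g. exp (- L * t) * walk_weight G lam (t / real k) k g"
  have le: "?w k g \<le> walk_prob M X t g" if "0 < k" "g \<in> carrier G" for k g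
    using walk_prob_ge[OF that(2) _ that(1), of "t / real k"] that \<open>0 \<le> t\<close>
    by (simp add: L_def flip: exp_of_nat_mult)
  have mass: "(\<Sum>g\<in>carrier G. ?w k g) = exp (- L * t) * (1 + (L * t) / real k) ^ k" for k
    by (simp add: sum_walk_weight[OF finite_group] L_def mult.commute flip: sum_distrib_left)
  have "walk_prob M X t g - ?w k g \<le> 1 - exp (- L * t) * (1 + (L * t) / real k) ^ k" if "0 < k" for k
  proof -
    \<comment> \<open>By the lower bounds all deficits are nonnegative, so a single one is at most
      their sum.\<close>
    have "walk_prob M X t g - ?w k g \<le> (\<Sum>g\<in>carrier G. walk_prob M X t g - ?w k g)"
      using le[OF that] assms(2) finite_group by (intro member_le_sum) auto
    then show ?thesis using mass sum_walk_prob[OF \<open>0 \<le> t\<close>] by (simp add: sum_subtractf)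
  qed
  then have upper: "\<forall>\<^sub>F k in sequentially.
      walk_prob M X t g - ?w k g \<le> 1 - exp (- L * t) * (1 + (L * t) / real k) ^ k"
    by (intro eventually_mono[OF eventually_gt_at_top[of 0]])
  have "(\<lambda>k. 1 - exp (- L * t) * (1 + (L * t) / real k) ^ k) \<longlonglongrightarrow> 1 - exp (- L * t) * exp (L * t)"
    by (intro tendsto_intros tendsto_exp_limit_sequentially)
  then have limit: "(\<lambda>k. 1 - exp (- L * t) * (1 + (L * t) / real k) ^ k) \<longlonglongrightarrow> 0"
    by (simp flip: exp_add)
  have lower: "\<forall>\<^sub>F k in sequentially. 0 \<le> walk_prob M X t g - ?w k g"
    using le[OF _ assms(2)] by (intro eventually_mono[OF eventually_gt_at_top[of 0]]) simp
  have "(\<lambda>k. walk_prob M X t g - ?w k g) \<longlonglongrightarrow> 0"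
    by (rule tendsto_sandwich[OF lower upper tendsto_const limit])
  from tendsto_diff[OF tendsto_const[of "walk_prob M X t g"] this] show ?thesis by simp
qed

end

section \<open>The dihedral group\<close>

locale dihedral = group G for G :: "('a, 'b) monoid_scheme" (structure) +
  fixes n :: nat and r b :: 'a
  assumes n_pos: "0 < n" and order_eq: "order G = 2 * n"
    and r_closed [simp]: "r \<in> carrier G" and b_closed [simp]: "b \<in> carrier G"
    and generators: "generate G {r, b} = carrier G"
    and r_pow: "r [^] n = \<one>" and b_square: "b \<otimes> b = \<one>" and b_conj: "b \<otimes> r \<otimes> b = inv r"
begin

definition rotation :: "int \<Rightarrow> 'a" where "rotation j = r [^] j"
definition reflection :: "int \<Rightarrow> 'a" where "reflection j = rotation j \<otimes> b"

lemma rot_closed [simp]: "rotation j \<in> carrier G" and refl_closed [simp]: "reflection j \<in> carrier G"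
  by (simp_all add: rotation_def reflection_def)

lemma rot_0 [simp]: "rotation 0 = \<one>" by (simp add: rotation_def)

lemma rot_rot: "rotation i \<otimes> rotation j = rotation (i + j)"
  by (simp add: rotation_def int_pow_mult)

lemma inv_rot: "inv (rotation j) = rotation (- j)"
  by (simp add: rotation_def int_pow_neg)

lemma rot_1: "rotation 1 = r" by (simp add: rotation_def)

lemma b_r: "b \<otimes> rotation 1 = rotation (- 1) \<otimes> b"
proof -
  have "b \<otimes> r = b \<otimes> r \<otimes> (b \<otimes> b)" by (simp add: b_square)
  also have "\<dots> = inv r \<otimes> b" by (simp add: m_assoc flip: b_conj)
  finally show ?thesis using inv_rot[of 1] by (simp add: rot_1)
qed

lemma b_inv_r: "b \<otimes> rotation (- 1) = rotation 1 \<otimes> b"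
proof -
  have "rotation 1 \<otimes> b = rotation 1 \<otimes> (b \<otimes> rotation 1) \<otimes> rotation (- 1)" by (simp add: m_assoc rot_rot)
  also have "\<dots> = (rotation 1 \<otimes> rotation (- 1)) \<otimes> b \<otimes> rotation (- 1)" unfolding b_r by (simp add: m_assoc)
  also have "\<dots> = b \<otimes> rotation (- 1)" by (simp add: rot_rot)
  finally show ?thesis ..
qed

lemma b_rot: "b \<otimes> rotation j = rotation (- j) \<otimes> b"
proof (induction j rule: int_induct[where k = 0])
  case (step1 i)
  have "b \<otimes> rotation (i + 1) = (b \<otimes> rotation i) \<otimes> rotation 1" by (simp add: m_assoc rot_rot)
  also have "\<dots> = rotation (- i) \<otimes> (b \<otimes> rotation 1)" unfolding step1 by (simp add: m_assoc)
  also have "\<dots> = (rotation (- i) \<otimes> rotation (- 1)) \<otimes> b" unfolding b_r by (simp add: m_assoc)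
  finally show ?case by (simp add: rot_rot)
next
  case (step2 i)
  have "b \<otimes> rotation (i - 1) = (b \<otimes> rotation i) \<otimes> rotation (- 1)" by (simp add: m_assoc rot_rot)
  also have "\<dots> = rotation (- i) \<otimes> (b \<otimes> rotation (- 1))" unfolding step2 by (simp add: m_assoc)
  also have "\<dots> = (rotation (- i) \<otimes> rotation 1) \<otimes> b" unfolding b_inv_r by (simp add: m_assoc)
  finally show ?case by (simp add: rot_rot)
qed simp

lemma rot_refl: "rotation i \<otimes> reflection j = reflection (i + j)"
  by (simp add: reflection_def rot_rot flip: m_assoc)

lemma refl_rot: "reflection i \<otimes> rotation j = reflection (i - j)"
proof -
  have "reflection i \<otimes> rotation j = rotation i \<otimes> (b \<otimes> rotation j)" by (simp add: reflection_def m_assoc)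
  also have "\<dots> = (rotation i \<otimes> rotation (- j)) \<otimes> b" unfolding b_rot by (simp add: m_assoc)
  finally show ?thesis by (simp add: reflection_def rot_rot)
qed

lemma refl_refl: "reflection i \<otimes> reflection j = rotation (i - j)"
proof -
  have "reflection i \<otimes> reflection j = (reflection i \<otimes> rotation j) \<otimes> b" by (simp add: reflection_def m_assoc)
  also have "\<dots> = rotation (i - j) \<otimes> (b \<otimes> b)" unfolding refl_rot by (simp add: reflection_def m_assoc)
  finally show ?thesis by (simp add: b_square)
qed

lemma inv_refl: "inv (reflection j) = reflection j"
  by (rule inv_equality) (simp_all add: refl_refl)

lemma rot_mod: "rotation (j mod int n) = rotation j"
proof -
  have "rotation (int n * (j div int n)) = (r [^] int n) [^] (j div int n)"
    unfolding rotation_def by (rule int_pow_pow[symmetric]) simp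
  also have "\<dots> = \<one>" using r_pow by (simp add: int_pow_int)
  finally have "rotation (int n * (j div int n)) \<otimes> rotation (j mod int n) = rotation (j mod int n)" by simp
  then show ?thesis unfolding rot_rot by simp
qed

lemma refl_mod: "reflection (j mod int n) = reflection j"
  by (simp add: reflection_def rot_mod)

text \<open>Rotations and reflections form a subgroup that contains both generators.\<close>

lemma carrier_eq: "carrier G = rotation ` {0..<int n} \<union> reflection ` {0..<int n}"
proof
  have "subgroup (range rotation \<union> range reflection) G"
    by (rule subgroupI) (auto simp: inv_rot inv_refl rot_rot rot_refl refl_rot refl_refl)
  moreover have "b = reflection 0" "r = rotation 1" by (simp_all add: reflection_def rot_1)
  then have "{r, b} \<subseteq> range rotation \<union> range reflection" by blast
  ultimately have "carrier G \<subseteq> range rotation \<union> range reflection"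
    using generate_subgroup_incl generators by blast
  moreover have "rotation j \<in> rotation ` {0..<int n}" "reflection j \<in> reflection ` {0..<int n}" for j
    using n_pos imageI[of "j mod int n" "{0..<int n}" rotation] imageI[of "j mod int n" "{0..<int n}" reflection]
    by (simp_all add: rot_mod refl_mod)
  ultimately show "carrier G \<subseteq> rotation ` {0..<int n} \<union> reflection ` {0..<int n}" by blast
qed auto

text \<open>Counting: two sets of at most n elements cover 2 n elements, so each has exactly n and
  they are disjoint. The order thus excludes proper quotients of the dihedral group.\<close>

lemma inj_rot: "inj_on rotation {0..<int n}"
  and inj_refl: "inj_on reflection {0..<int n}"
  and rot_refl_disjoint: "rotation ` {0..<int n} \<inter> reflection ` {0..<int n} = {}"
proof -
  let ?R = "rotation ` {0..<int n}" and ?S = "reflection ` {0..<int n}"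
  have le: "card ?R \<le> n" "card ?S \<le> n"
    using card_image_le[of "{0..<int n}" rotation] card_image_le[of "{0..<int n}" reflection] by auto
  have "card (?R \<union> ?S) = 2 * n" using order_eq by (simp add: order_def carrier_eq)
  moreover have "card (?R \<union> ?S) + card (?R \<inter> ?S) = card ?R + card ?S"
    by (rule card_Un_Int[symmetric]) auto
  ultimately have "card ?R = n" "card ?S = n" "card (?R \<inter> ?S) = 0" using le by linarith+
  then show "inj_on rotation {0..<int n}" "inj_on reflection {0..<int n}" "?R \<inter> ?S = {}"
    by (simp_all add: eq_card_imp_inj_on)
qed

lemma sum_carrier: "(\<Sum>g\<in>carrier G. \<phi> g) = (\<Sum>j\<in>{0..<int n}. \<phi> (rotation j) + \<phi> (reflection j))"
  unfolding carrier_eq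
  by (simp add: sum.union_disjoint rot_refl_disjoint sum.reindex inj_rot inj_refl sum.distrib)

lemma rot_eq_one_iff: "rotation j = \<one> \<longleftrightarrow> int n dvd j"
proof -
  have "rotation j = \<one> \<longleftrightarrow> rotation (j mod int n) = rotation 0" by (simp add: rot_mod)
  also have "\<dots> \<longleftrightarrow> j mod int n = 0" using inj_rot n_pos by (auto simp: inj_on_def)
  finally show ?thesis by (simp add: dvd_eq_mod_eq_0)
qed

lemma refl_neq_one: "reflection j \<noteq> \<one>"
proof
  assume "reflection j = \<one>"
  then have "reflection (j mod int n) = rotation 0" by (simp add: refl_mod)
  then show False using rot_refl_disjoint n_pos by (auto simp: disjoint_iff) (metis atLeastLessThan_iff
    image_eqI of_nat_0_less_iff order_refl pos_mod_bound pos_mod_sign rot_0)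
qed

end

section \<open>Fourier transform of the law of the walk\<close>

lemma tendsto_synth:
  assumes "\<And>k. k \<in> {0..<int n} \<Longrightarrow> ((\<lambda>i. C i k) \<longlongrightarrow> D k) \<F>"
  shows "((\<lambda>i. synth n (C i) j) \<longlongrightarrow> synth n D j) \<F>"
  unfolding synth_def divide_inverse
  by (intro tendsto_mult tendsto_const tendsto_Re tendsto_sum assms)

lemma tendsto_power_exp: "(\<lambda>k. (1 + t / real k * c) ^ k) \<longlonglongrightarrow> exp (t * c)"
  using tendsto_exp_limit_sequentially[of "t * c"] by simp

locale dihedral_rates = dihedral +
  fixes lam :: "'a \<Rightarrow> real"
  assumes symmetric: "symmetric_rates G lam"
begin

definition rot_rate :: "int \<Rightarrow> real" where "rot_rate l = lam (rotation l)"
definition refl_rate :: "int \<Rightarrow> real" where "refl_rate l = lam (reflection l)"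

text \<open>In representation \<open>k\<close> the jump operator is the matrix with diagonal
  \<open>rot_eigen k\<close> and with \<open>refl_eigen k\<close> and its conjugate off the
  diagonal. Its eigenvalues are \<open>rot_eigen k\<close> plus and minus
  \<open>norm (refl_eigen k)\<close>.\<close>

definition rot_eigen :: "int \<Rightarrow> real" where
  "rot_eigen k = (\<Sum>l\<in>{0..<int n}. rot_rate l * Re (unity_root n (l * k)))"

abbreviation refl_eigen :: "int \<Rightarrow> complex" where "refl_eigen \<equiv> refl_coef n refl_rate"

lemma rot_eigen_eq: "rot_coef n rot_rate refl_rate k = rot_eigen k - (\<Sum>s\<in>carrier G. lam s)"
  by (simp add: rot_coef_def rot_eigen_def sum_carrier rot_rate_def refl_rate_def algebra_simps
      sum.distrib sum_subtractf)

text \<open>Inverse rotations have equal rates, so reflecting the index shows that the sum equals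
  its conjugate. Symmetry of the rates enters here.\<close>

lemma rot_rate_sum:
  "(\<Sum>l\<in>{0..<int n}. of_real (rot_rate l) * unity_root n (l * k)) = of_real (rot_eigen k)"
  "(\<Sum>l\<in>{0..<int n}. of_real (rot_rate l) * unity_root n (- l * k)) = of_real (rot_eigen k)"
proof -
  let ?S = "\<Sum>l\<in>{0..<int n}. of_real (rot_rate l) * unity_root n (l * k)"
  let ?T = "\<Sum>l\<in>{0..<int n}. of_real (rot_rate l) * unity_root n (- l * k)"
  have sym: "rot_rate (- l) = rot_rate l" for l
    using bspec[OF symmetric[unfolded symmetric_rates_def] rot_closed[of l]]
    by (simp add: rot_rate_def inv_rot)
  have "(\<Sum>l\<in>{0..<int n}. of_real (rot_rate (0 - l)) * unity_root n ((0 - l) * k)) = ?S"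
    by (rule periodic_sum_reflect[OF n_pos, of "\<lambda>l. of_real (rot_rate l) * unity_root n (l * k)"])
       (simp add: unity_root_mod_mult[OF n_pos] rot_rate_def rot_mod)
  then have "?T = ?S" by (simp add: sym)
  moreover have "?T = cnj ?S" by (simp add: unity_root_minus)
  ultimately have "?S = cnj ?S" by simp
  then have "?S = of_real (Re ?S)" by (metis Reals_cnj_iff of_real_Re)
  also have "Re ?S = rot_eigen k" by (simp add: rot_eigen_def)
  finally show "?S = of_real (rot_eigen k)" .
  with \<open>?T = ?S\<close> show "?T = of_real (rot_eigen k)" by simp
qed

text \<open>Diagonal entry of the i-th power of I + h times the jump matrix, expressed by the two
  eigenvalues.\<close>

definition rot_iter :: "real \<Rightarrow> nat \<Rightarrow> int \<Rightarrow> real" where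
  "rot_iter h i k = ((1 + h * (rot_eigen k + norm (refl_eigen k))) ^ i
     + (1 + h * (rot_eigen k - norm (refl_eigen k))) ^ i) / 2"

text \<open>Off-diagonal entry of the same power. If \<open>refl_eigen k\<close> is 0, the phase
  \<open>sgn\<close> is 0, in accordance with the two eigenvalues being equal.\<close>

definition refl_iter :: "real \<Rightarrow> nat \<Rightarrow> int \<Rightarrow> complex" where
  "refl_iter h i k = of_real (((1 + h * (rot_eigen k + norm (refl_eigen k))) ^ i
     - (1 + h * (rot_eigen k - norm (refl_eigen k))) ^ i) / 2) * sgn (refl_eigen k)"

lemma norm_mult_sgn: "of_real (norm z) * sgn z = (z :: complex)"
  by (cases "z = 0") (auto simp: sgn_eq)

lemma cnj_mult_sgn: "cnj z * sgn z = of_real (norm z)"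
  by (cases "z = 0") (auto simp: sgn_eq complex_norm_square[symmetric] power2_eq_square mult.commute[of "cnj z"])

text \<open>One more matrix factor is applied to the first column of the power; this is the first
  row of the result, and \<open>refl_iter_Suc\<close> is the second.\<close>

lemma rot_iter_Suc: "of_real (rot_iter h (Suc i) k) = of_real (rot_iter h i k)
    + of_real h * (of_real (rot_eigen k) * of_real (rot_iter h i k) + cnj (refl_eigen k) * refl_iter h i k)"
proof -
  define p m where "p = (1 + h * (rot_eigen k + norm (refl_eigen k))) ^ i / 2"
    and "m = (1 + h * (rot_eigen k - norm (refl_eigen k))) ^ i / 2"
  have "cnj (refl_eigen k) * refl_iter h i k = of_real (p - m) * (cnj (refl_eigen k) * sgn (refl_eigen k))"
    by (simp add: refl_iter_def p_def m_def diff_divide_distrib)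
  then have 1: "cnj (refl_eigen k) * refl_iter h i k = of_real ((p - m) * norm (refl_eigen k))"
    unfolding cnj_mult_sgn by simp
  have 2: "rot_iter h (Suc i) k = p + m + h * (rot_eigen k * (p + m) + (p - m) * norm (refl_eigen k))"
    by (simp add: rot_iter_def p_def m_def field_simps)
  have 3: "rot_iter h i k = p + m" by (simp add: rot_iter_def p_def m_def add_divide_distrib)
  show ?thesis unfolding 1 2 3 by simp
qed

lemma refl_iter_Suc: "refl_iter h (Suc i) k = refl_iter h i k
    + of_real h * (of_real (rot_eigen k) * refl_iter h i k + refl_eigen k * of_real (rot_iter h i k))"
proof -
  define p m where "p = (1 + h * (rot_eigen k + norm (refl_eigen k))) ^ i / 2"
    and "m = (1 + h * (rot_eigen k - norm (refl_eigen k))) ^ i / 2"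
  define s where "s = sgn (refl_eigen k)"
  have "rot_iter h i k = p + m" by (simp add: rot_iter_def p_def m_def add_divide_distrib)
  then have 1: "refl_eigen k * of_real (rot_iter h i k) = of_real ((p + m) * norm (refl_eigen k)) * s"
    by (subst norm_mult_sgn[symmetric]) (simp add: s_def)
  have 2: "refl_iter h (Suc i) k = of_real (p - m
      + h * (rot_eigen k * (p - m) + (p + m) * norm (refl_eigen k))) * s"
    unfolding refl_iter_def s_def
    by (intro arg_cong2[of _ _ _ _ "(*)"] arg_cong[of _ _ of_real] refl) (simp add: p_def m_def field_simps)
  have 3: "refl_iter h i k = of_real (p - m) * s"
    by (simp add: refl_iter_def p_def m_def s_def diff_divide_distrib)
  show ?thesis unfolding 1 2 3 by (simp add: algebra_simps)
qed

text \<open>Translations in the recursion of \<open>walk_weight\<close> become characters, so each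
  frequency separately follows the recursion of the matrix powers.\<close>

lemma walk_weight_fourier:
  "walk_weight G lam h i (rotation j) = synth n (\<lambda>k. of_real (rot_iter h i k)) j
   \<and> walk_weight G lam h i (reflection j) = synth n (refl_iter h i) j"
proof (induction i arbitrary: j)
  case 0
  have "walk_weight G lam h 0 (rotation j) = synth n (\<lambda>k. of_real (rot_iter h 0 k)) j"
    using sum_unity_root[OF n_pos, of j] n_pos
    by (simp add: synth_def rot_iter_def rot_eq_one_iff mult.commute[of j] del: Re_sum)
  then show ?case by (simp add: refl_neq_one refl_iter_def synth_def)
next
  case (Suc i)
  let ?Z = "{0..<int n}"
  let ?w = "walk_weight G lam h i"
  let ?F = "\<lambda>k. complex_of_real (rot_iter h i k)" and ?H = "refl_iter h i"
  have "walk_weight G lam h (Suc i) (rotation j) = ?w (rotation j)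
      + h * (\<Sum>l\<in>?Z. rot_rate l * ?w (rotation (j + - l)) + refl_rate l * ?w (reflection (j + l)))"
    by (simp add: sum_carrier inv_rot inv_refl rot_rot rot_refl rot_rate_def refl_rate_def)
  also have "\<dots> = synth n (\<lambda>k. ?F k + of_real h * (\<Sum>l\<in>?Z. of_real (rot_rate l) * (?F k * unity_root n (- l * k))
      + of_real (refl_rate l) * (?H k * unity_root n (l * k)))) j"
    unfolding synth_add synth_scale synth_sum synth_shift by (simp add: Suc.IH)
  also have "\<dots> = synth n (\<lambda>k. of_real (rot_iter h (Suc i) k)) j"
  proof (rule synth_cong)
    fix k
    \<comment> \<open>A rotation with index \<open>j\<close> is reached from the reflection with
      index \<open>j + l\<close>, so the characters here are conjugate to those in
      \<open>refl_coef\<close>.\<close>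
    have "cnj (refl_eigen k) = (\<Sum>l\<in>?Z. of_real (refl_rate l) * unity_root n (l * k))"
      by (simp add: refl_coef_def unity_root_minus)
    then show "?F k + of_real h * (\<Sum>l\<in>?Z. of_real (rot_rate l) * (?F k * unity_root n (- l * k))
      + of_real (refl_rate l) * (?H k * unity_root n (l * k))) = of_real (rot_iter h (Suc i) k)"
      unfolding rot_iter_Suc rot_rate_sum(2)[symmetric]
      by (simp add: sum.distrib sum_distrib_right mult.assoc mult.commute[of "?F k"] mult.commute[of "?H k"])
  qed
  finally have rot: "walk_weight G lam h (Suc i) (rotation j) = synth n (\<lambda>k. of_real (rot_iter h (Suc i) k)) j" .
  have "walk_weight G lam h (Suc i) (reflection j) = ?w (reflection j)
      + h * (\<Sum>l\<in>?Z. rot_rate l * ?w (reflection (j + l)) + refl_rate l * ?w (rotation (j + - l)))"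
    by (simp add: sum_carrier inv_rot inv_refl refl_rot refl_refl rot_rate_def refl_rate_def)
  also have "\<dots> = synth n (\<lambda>k. ?H k + of_real h * (\<Sum>l\<in>?Z. of_real (rot_rate l) * (?H k * unity_root n (l * k))
      + of_real (refl_rate l) * (?F k * unity_root n (- l * k)))) j"
    unfolding synth_add synth_scale synth_sum synth_shift by (simp add: Suc.IH)
  also have "\<dots> = synth n (refl_iter h (Suc i)) j"
  proof (rule synth_cong)
    fix k
    show "?H k + of_real h * (\<Sum>l\<in>?Z. of_real (rot_rate l) * (?H k * unity_root n (l * k))
      + of_real (refl_rate l) * (?F k * unity_root n (- l * k))) = refl_iter h (Suc i) k"
      unfolding refl_iter_Suc rot_rate_sum(1)[symmetric] refl_coef_def
      by (simp add: sum.distrib sum_distrib_right mult.assoc mult.commute[of "?F k"] mult.commute[of "?H k"])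
  qed
  finally show ?case using rot by simp
qed

text \<open>In the limit of \<open>walk_prob_limit\<close> the powers in \<open>rot_iter\<close> and
  \<open>refl_iter\<close> tend to exponentials, and the factor exp (- L t) turns
  \<open>rot_eigen\<close> into \<open>rot_coef\<close>. Uniqueness of limits identifies the
  law.\<close>

lemma walk_prob_fourier:
  assumes walk: "random_walk M G lam N X" and t: "0 \<le> t"
  shows "walk_prob M X t (rotation j) - 1 / real (order G)
      = synth n (\<lambda>k. of_real (rot_mode n t rot_rate refl_rate k)) j"
    and "walk_prob M X t (reflection j) - 1 / real (order G)
      = synth n (refl_mode n t rot_rate refl_rate) j"
proof -
  interpret W: random_walk M G lam N X by (rule walk)
  define L where "L = (\<Sum>s\<in>carrier G. lam s)"
  let ?a = "rot_coef n rot_rate refl_rate" and ?\<beta> = "\<lambda>k. norm (refl_eigen k)"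
  have exps: "exp (- L * t) * (exp (t * (rot_eigen k + ?\<beta> k)) + exp (t * (rot_eigen k - ?\<beta> k))) / 2
      = diag_entry t (?a k) (refl_eigen k)"
    "of_real (exp (- L * t) * ((exp (t * (rot_eigen k + ?\<beta> k)) - exp (t * (rot_eigen k - ?\<beta> k))) / 2))
      * sgn (refl_eigen k) = offdiag_entry t (?a k) (refl_eigen k)" for k
  proof -
    have e: "exp (- L * t) * exp (t * (rot_eigen k + x)) = exp (t * ?a k) * exp (t * x)" for x
      unfolding rot_eigen_eq L_def[symmetric] exp_add[symmetric] by (simp add: algebra_simps)
    have e': "exp (- L * t) * exp (t * (rot_eigen k - x)) = exp (t * ?a k) * exp (- (t * x))" for x
      using e[of "- x"] by simp
    show "exp (- L * t) * (exp (t * (rot_eigen k + ?\<beta> k)) + exp (t * (rot_eigen k - ?\<beta> k))) / 2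
      = diag_entry t (?a k) (refl_eigen k)"
      unfolding distrib_left[of "exp (- L * t)"] e e' diag_entry_def cosh_sqrt_square cosh_def by (simp add: algebra_simps)
    have "exp (- L * t) * ((exp (t * (rot_eigen k + ?\<beta> k)) - exp (t * (rot_eigen k - ?\<beta> k))) / 2)
       = exp (t * ?a k) * sinh (t * ?\<beta> k)"
      unfolding times_divide_eq_right right_diff_distrib[of "exp (- L * t)"] e e' sinh_def by (simp add: field_simps)
    also have "\<dots> = exp (t * ?a k) * t * sinhc_sqrt ((t * ?\<beta> k)\<^sup>2) * ?\<beta> k"
      by (simp flip: sinhc_sqrt_square)
    finally show "of_real (exp (- L * t) * ((exp (t * (rot_eigen k + ?\<beta> k)) - exp (t * (rot_eigen k - ?\<beta> k))) / 2))
      * sgn (refl_eigen k) = offdiag_entry t (?a k) (refl_eigen k)"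
      unfolding offdiag_entry_def using norm_mult_sgn[of "refl_eigen k"]
      by (simp only: of_real_mult mult.assoc)
  qed
  \<comment> \<open>On each half the uniform distribution has the single mode 1/2 at frequency 0:
    \<open>synth\<close> divides by n, while the order is 2 n.\<close>
  have half: "synth n (\<lambda>k. if k = 0 then 1 / 2 else 0) j = 1 / real (order G)"
    using n_pos by (simp add: synth_def order_eq if_distrib[of "\<lambda>c. c * _"] cong: if_cong)
  have "(\<lambda>K. synth n (\<lambda>k. of_real (exp (- L * t)) * of_real (rot_iter (t / real K) K k)) j) \<longlonglongrightarrow>
      synth n (\<lambda>k. of_real (diag_entry t (?a k) (refl_eigen k))) j"
    unfolding exps(1)[symmetric] rot_iter_def of_real_mult[symmetric] times_divide_eq_right[symmetric]
    by (intro tendsto_synth tendsto_of_real tendsto_mult tendsto_divide tendsto_add tendsto_power_exp tendsto_const) auto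
  then have eq: "walk_prob M X t (rotation j) = synth n (\<lambda>k. of_real (diag_entry t (?a k) (refl_eigen k))) j"
    using W.walk_prob_limit[OF t, of "rotation j"]
    unfolding L_def[symmetric] synth_scale by (simp add: walk_weight_fourier LIMSEQ_unique)
  show "walk_prob M X t (rotation j) - 1 / real (order G)
      = synth n (\<lambda>k. of_real (rot_mode n t rot_rate refl_rate k)) j"
    unfolding eq half[symmetric] synth_diff[symmetric] rot_mode_def by (intro synth_cong) simp
  have "(\<lambda>K. synth n (\<lambda>k. of_real (exp (- L * t)) * refl_iter (t / real K) K k) j) \<longlonglongrightarrow>
      synth n (\<lambda>k. offdiag_entry t (?a k) (refl_eigen k)) j"
    unfolding exps(2)[symmetric] refl_iter_def mult.assoc[symmetric] of_real_mult[symmetric]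
    by (intro tendsto_synth tendsto_of_real tendsto_mult tendsto_divide tendsto_diff tendsto_power_exp tendsto_const) auto
  then have eq': "walk_prob M X t (reflection j) = synth n (\<lambda>k. offdiag_entry t (?a k) (refl_eigen k)) j"
    using W.walk_prob_limit[OF t, of "reflection j"]
    unfolding L_def[symmetric] synth_scale by (simp add: walk_weight_fourier LIMSEQ_unique)
  show "walk_prob M X t (reflection j) - 1 / real (order G)
      = synth n (refl_mode n t rot_rate refl_rate) j"
    unfolding eq' half[symmetric] synth_diff[symmetric] by (intro synth_cong) (simp add: refl_mode_def)
qed

lemma lp_distance_fourier:
  assumes walk: "random_walk M G lam N X" and t: "0 \<le> t" and "1 \<le> m"
  shows "lp_distance G (real (2 * m)) M X t =
    (\<Sum>j\<in>{0..<int n}. synth n (\<lambda>k. of_real (rot_mode n t rot_rate refl_rate k)) j ^ (2 * m)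
       + synth n (refl_mode n t rot_rate refl_rate) j ^ (2 * m)) powr (1 / real (2 * m))"
proof -
  \<comment> \<open>Base 0 is treated apart: \<open>0 powr p\<close> is 0 for every p, which agrees
    with the power because \<open>2 * m\<close> is positive.\<close>
  have "\<bar>x\<bar> powr real (2 * m) = x ^ (2 * m)" for x :: real
    using \<open>1 \<le> m\<close> powr_realpow[of "\<bar>x\<bar>" "2 * m"] by (cases "x = 0") (simp_all add: power_even_abs)
  then show ?thesis
    unfolding lp_distance_def by (simp only: sum_carrier walk_prob_fourier[OF walk t])
qed

end

section \<open>Comparison of two rate collections on one dihedral group\<close>

theorem theorem1:
  fixes G :: "('a, 'b) monoid_scheme"
    and m n :: nat
    and lam lam' :: "'a \<Rightarrow> real"
    and M :: "'w measure" and M' :: "'v measure"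
    and N :: "'a \<Rightarrow> real \<Rightarrow> 'w \<Rightarrow> nat" and N' :: "'a \<Rightarrow> real \<Rightarrow> 'v \<Rightarrow> nat"
    and X :: "real \<Rightarrow> 'w \<Rightarrow> 'a" and X' :: "real \<Rightarrow> 'v \<Rightarrow> 'a"
    and t :: real
  assumes "m \<ge> 1" and "n \<ge> 1"
    and "dihedral_group n G"
    and "rate_collection G lam" and "symmetric_rates G lam" and "generating_rates G lam"
    and "rate_collection G lam'" and "symmetric_rates G lam'" and "generating_rates G lam'"
    and "\<forall>s\<in>carrier G. lam s \<le> lam' s"
    and "random_walk M G lam N X"
    and "random_walk M' G lam' N' X'"
    and "t \<ge> 0"
  shows "lp_distance G (real (2 * m)) M X t \<ge> lp_distance G (real (2 * m)) M' X' t"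
proof -
  have G: "group G" and order: "order G = 2 * n"
    using \<open>dihedral_group n G\<close> unfolding dihedral_group_def by auto
  obtain r b where rb: "r \<in> carrier G" "b \<in> carrier G" "generate G {r, b} = carrier G"
    "r [^]\<^bsub>G\<^esub> n = \<one>\<^bsub>G\<^esub>" "b [^]\<^bsub>G\<^esub> (2::nat) = \<one>\<^bsub>G\<^esub>" "b \<otimes>\<^bsub>G\<^esub> r \<otimes>\<^bsub>G\<^esub> b = inv\<^bsub>G\<^esub> r"
    using \<open>dihedral_group n G\<close> unfolding dihedral_group_def by auto
  interpret group G by (rule G)
  have "b \<otimes>\<^bsub>G\<^esub> b = \<one>\<^bsub>G\<^esub>" using rb by (simp add: numeral_2_eq_2)
  then interpret dihedral G n r b
    using rb order \<open>n \<ge> 1\<close> by unfold_locales auto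
  \<comment> \<open>Both collections are read through the same \<open>r\<close> and
    \<open>b\<close>, so their comparison on the group becomes one of \<open>rot_rate\<close> and
    \<open>refl_rate\<close> at each index.\<close>
  interpret A: dihedral_rates G n r b lam by unfold_locales fact
  interpret B: dihedral_rates G n r b lam' by unfold_locales fact
  have "(\<Sum>j\<in>{0..<int n}. synth n (\<lambda>k. of_real (rot_mode n t B.rot_rate B.refl_rate k)) j ^ (2 * m)
       + synth n (refl_mode n t B.rot_rate B.refl_rate) j ^ (2 * m))
    \<le> (\<Sum>j\<in>{0..<int n}. synth n (\<lambda>k. of_real (rot_mode n t A.rot_rate A.refl_rate k)) j ^ (2 * m)
       + synth n (refl_mode n t A.rot_rate A.refl_rate) j ^ (2 * m))"
    using \<open>rate_collection G lam\<close> \<open>\<forall>s\<in>carrier G. lam s \<le> lam' s\<close> \<open>t \<ge> 0\<close> n_pos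
    by (intro even_power_sum_antimono)
       (auto simp: A.rot_rate_def A.refl_rate_def B.rot_rate_def B.refl_rate_def rate_collection_def)
  then show ?thesis
    unfolding A.lp_distance_fourier[OF \<open>random_walk M G lam N X\<close> \<open>t \<ge> 0\<close> \<open>m \<ge> 1\<close>]
      B.lp_distance_fourier[OF \<open>random_walk M' G lam' N' X'\<close> \<open>t \<ge> 0\<close> \<open>m \<ge> 1\<close>]
    by (intro powr_mono2 sum_nonneg add_nonneg_nonneg zero_le_even_power) auto
qed

end
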